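(* Consider a dimer model on a finite bipartite planar graph $G$ with Kasteleyn coefficients of the form $K^{(t)}_{w,b}=H_t(\beta,\alpha)$, where $H_t$ is a function of the half-angles of the two train-tracks crossing the edge $wb$, antisymmetric ($H_t(\beta,\alpha)=-H_t(\alpha,\beta)$), and where $t=t(w)$ is constant on the four white vertices appearing in any spider move with black boundary vertices. The following conditions are equivalent: (1) The face-weight partition function, seen as a function of the train-track parameters, is invariant under spider moves with black boundary vertices. (2) For all $(a,b,c,d)\in\mathbb C^4$ and $t\in\mathbb C$, $$H_t(a,b)H_t(c,d)+H_t(a,c)H_t(d,b)+H_t(a,d)H_t(b,c)=0.$$ In such a case, the kernel of $K^{(t)}:\mathbb C^B\to\mathbb C^W$ is invariant under spider moves with black boundary vertices.
   Context: Conventions. $G$ is a finite bipartite planar graph with black and white vertex sets $B,W$; train-tracks are the paths crossing opposite edges of the quadrilaterals of the quad-graph (the graph on vertices and faces of $G$, each quadrilateral having an edge of $G$ as a diagonal), oriented with black vertices on the right and white vertices on the left, and each carries a parameter (half-angle). White vertices are assumed trivalent (this can always be arranged by shrinking/expanding $2$-valent vertices). For an edge $wb$, let $w,f',b,f$ be the vertices in counterclockwise order of the quadrilateral containing it; $\alpha$ is the parameter of the train-track crossing $wf'$ and $bf$, $\beta$ that of the train-track crossing $wf$ and $bf'$. Edge weights may be arbitrary complex numbers (non-zero where they appear in denominators). The face weight of a face $f$ with boundary vertices $w_1,b_1,\dots,w_n,b_n$ in counterclockwise order is $\mathcal W_f=(-1)^{n+1}\prod_{j}\frac{K_{w_j,b_j}}{K_{w_j,b_{j-1}}}$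 (cyclic indices), and the face-weight partition function is $Z(G,\mathcal W)=\sum_M\prod_f\mathcal W_f^{h_M(f)}$ over dimer configurations (perfect matchings) $M$, where $h_M$ is the height function of $M$ with respect to a reference dimer configuration $M_1$: $M-M_1=\partial(\sum_fh_M(f)f)$. Spider move with black boundary vertices. Let $b_1,b_2,b_3,b_4$ be black vertices at top, left, bottom, right respectively. In $G$, there are two white vertices: $w_1$ adjacent to $b_1,b_2,b_3$ and $w_2$ adjacent to $b_1,b_3,b_4$, bounding the quadrangular face $f=(w_1,b_3,w_2,b_1)$. In $G'$, these are replaced by $w_1'$ adjacent to $b_1,b_2,b_4$ and $w_2'$ adjacent to $b_2,b_3,b_4$, bounding the quadrangular face $f'$; the rest of the graph and its Kasteleyn coefficients are unchanged. The outer faces adjacent to the configuration are $f_1$ (between $b_1,b_2$), $f_2$ (between $b_2,b_3$), $f_3$ (between $b_3,b_4$), $f_4$ (between $b_4,b_1$), with counterparts $f_i'$ in $G'$. If $a,b,c,d$ are the parameters of the four train-tracks involved, the coefficients are: in $G$, $K_{w_1,b_1}=H_t(b,d)$, $K_{w_1,b_2}=H_t(a,b)$, $K_{w_1,b_3}=H_t(d,a)$, $K_{w_2,b_1}=H_t(c,b)$, $K_{w_2,b_3}=H_t(a,c)$, $K_{w_2,b_4}=H_t(b,a)$; in $G'$, $K_{w_1',b_1}=H_t(c,d)$, $K_{w_1',b_2}=H_t(a,c)$, $K_{w_1',b_4}=H_t(d,a)$, $K_{w_2',b_2}=H_t(c,b)$, $K_{w_2',b_3}=H_t(d,c)$, $K_{w_2',b_4}=H_t(b,d)$.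 Invariance of the face-weight partition function under the spider move means that $G$ and $G'$ have identical face-weight partition functions for all values of the train-track parameters; by the standard rule (Postnikov, Goncharov–Kenyon) this amounts to $\mathcal W_{f'}=\mathcal W_f^{-1}$, $\mathcal W_{f_i'}=\mathcal W_{f_i}(1+\mathcal W_f)$ for $i=1,3$, and $\mathcal W_{f_j'}=\mathcal W_{f_j}(1+\mathcal W_f^{-1})^{-1}$ for $j=2,4$. Invariance of the kernel means that $\ker K^{(t)}$ and $\ker K'^{(t)}$ coincide as subspaces of $\mathbb C^B=\mathbb C^{B'}$.
   Formalization: Added: values of H_t at distinct parameters are limits of values with all six coefficients nonzero (else (1) may be vacuous while (2) fails). Reference dimers are those forced by their part off the site; kernel claim assumes H_t(a,b), H_t(c,d) nonzero. *)

theory Defs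
  imports "HOL-Analysis.Analysis" "HOL-Combinatorics.Orbits" "HOL-Combinatorics.Permutations"
begin

text \<open>
  A bipartite graph embedded in the sphere is given by its rotation system: \<open>rotW\<close> (\<open>rotB\<close>) sends
  an edge to the next edge in counterclockwise order around its white (black) endpoint. Parallel
  edges are allowed. The marked face \<open>outer\<close> is the unbounded face of the planar drawing.
\<close>

record bgraph =
  edges :: "nat set"
  white_of :: "nat \<Rightarrow> nat"
  black_of :: "nat \<Rightarrow> nat"
  rotW :: "nat \<Rightarrow> nat"
  rotB :: "nat \<Rightarrow> nat"
  outer :: "nat set"

definition whites :: "bgraph \<Rightarrow> nat set" where
  "whites G = white_of G ` edges G"

definition blacks :: "bgraph \<Rightarrow> nat set" where
  "blacks G = black_of G ` edges G"

text \<open>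
  Let \<open>e\<close> join \<open>w\<close> to \<open>b\<close>. Following a face counterclockwise (face on the left) along \<open>e\<close> from \<open>w\<close>
  to \<open>b\<close> and then from \<open>b\<close> to the next white vertex, the next edge traversed from white to black is
  \<open>rotW\<inverse> (rotB\<inverse> e)\<close>. So the faces are the orbits of \<open>rotB \<circ> rotW\<close>, a face being represented by the
  set of edges having it on the left when traversed from white to black. A face with boundary
  \<open>w\<^sub>1, b\<^sub>1, \<dots>, w\<^sub>n, b\<^sub>n\<close> is thus the set of the \<open>n\<close> edges \<open>w\<^sub>j b\<^sub>j\<close>. The face on the right of \<open>e\<close> is the
  one on the left of the counterclockwise successor of \<open>e\<close> around \<open>b\<close>. In the quadrilateral
  \<open>w, f', b, f\<close> of \<open>e\<close>, the face \<open>f\<close> is the left one and \<open>f'\<close> the right one.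
\<close>

definition left_face :: "bgraph \<Rightarrow> nat \<Rightarrow> nat set" where
  "left_face G e = orbit (rotB G \<circ> rotW G) e"

definition right_face :: "bgraph \<Rightarrow> nat \<Rightarrow> nat set" where
  "right_face G e = left_face G (rotB G e)"

definition faces :: "bgraph \<Rightarrow> nat set set" where
  "faces G = left_face G ` edges G"

text \<open>Planarity of a connected rotation system is Euler's formula.\<close>

definition planar_bipartite :: "bgraph \<Rightarrow> bool" where
  "planar_bipartite G \<longleftrightarrow>
     finite (edges G) \<and> edges G \<noteq> {} \<and>
     rotW G permutes edges G \<and> rotB G permutes edges G \<and>
     (\<forall>e\<in>edges G. \<forall>e'\<in>edges G. white_of G e = white_of G e' \<longleftrightarrow> e' \<in> orbit (rotW G) e) \<and>
     (\<forall>e\<in>edges G. \<forall>e'\<in>edges G. black_of G e = black_of G e' \<longleftrightarrow> e' \<in> orbit (rotB G) e) \<and>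
     (\<forall>A. A \<subseteq> edges G \<and> A \<noteq> {} \<and> rotW G ` A \<subseteq> A \<and> rotB G ` A \<subseteq> A \<longrightarrow> A = edges G) \<and>
     card (whites G) + card (blacks G) + card (faces G) = card (edges G) + 2 \<and>
     outer G \<in> faces G"

definition white_trivalent :: "bgraph \<Rightarrow> bool" where
  "white_trivalent G \<longleftrightarrow> (\<forall>w\<in>whites G. card {e \<in> edges G. white_of G e = w} = 3)"

text \<open>
  Two train-tracks cross the quadrilateral of an edge \<open>e\<close>: one through its sides \<open>wf'\<close> and \<open>bf\<close>,
  with parameter \<open>\<alpha> e\<close>, and one through its sides \<open>wf\<close> and \<open>bf'\<close>, with parameter \<open>\<beta> e\<close>. The side
  \<open>wf\<close> of \<open>e\<close> is the side \<open>wf'\<close> of \<open>rotW e\<close>, and the side \<open>bf'\<close> of \<open>e\<close> is the side \<open>bf\<close> of \<open>rotB e\<close>.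
  So the following says that \<open>\<alpha>, \<beta>\<close> come from one parameter for each train-track.
\<close>

definition track_parameters :: "bgraph \<Rightarrow> (nat \<Rightarrow> complex) \<Rightarrow> (nat \<Rightarrow> complex) \<Rightarrow> bool" where
  "track_parameters G \<alpha> \<beta> \<longleftrightarrow>
     (\<forall>e\<in>edges G. \<alpha> (rotW G e) = \<beta> e \<and> \<alpha> (rotB G e) = \<beta> e)"

definition kasteleyn ::
    "(complex \<Rightarrow> complex \<Rightarrow> complex \<Rightarrow> complex) \<Rightarrow> (nat \<Rightarrow> complex) \<Rightarrow> bgraph \<Rightarrow>
     (nat \<Rightarrow> complex) \<Rightarrow> (nat \<Rightarrow> complex) \<Rightarrow> nat \<Rightarrow> complex" where
  "kasteleyn H t G \<alpha> \<beta> e = H (t (white_of G e)) (\<beta> e) (\<alpha> e)"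

definition kasteleyn_kernel :: "bgraph \<Rightarrow> (nat \<Rightarrow> complex) \<Rightarrow> (nat \<Rightarrow> complex) set" where
  "kasteleyn_kernel G K =
     {x \<in> blacks G \<rightarrow>\<^sub>E UNIV.
        \<forall>w\<in>whites G. (\<Sum>e | e \<in> edges G \<and> white_of G e = w. K e * x (black_of G e)) = 0}"

definition face_weight :: "bgraph \<Rightarrow> (nat \<Rightarrow> complex) \<Rightarrow> nat set \<Rightarrow> complex" where
  "face_weight G K f =
     (- 1) ^ (card f + 1) *
     ((\<Prod>e | e \<in> edges G \<and> left_face G e = f. K e) /
      (\<Prod>e | e \<in> edges G \<and> right_face G e = f. K e))"

definition dimer :: "bgraph \<Rightarrow> nat set \<Rightarrow> bool" where
  "dimer G M \<longleftrightarrow>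
     M \<subseteq> edges G \<and>
     (\<forall>w\<in>whites G. \<exists>!e. e \<in> M \<and> white_of G e = w) \<and>
     (\<forall>b\<in>blacks G. \<exists>!e. e \<in> M \<and> black_of G e = b)"

text \<open>
  \<open>M - M\<^sub>1 = \<partial>(\<Sum>f. h f \<cdot> f)\<close>, with edges oriented from white to black, faces oriented
  counterclockwise, and \<open>h\<close> zero on the unbounded face.
\<close>

definition height_function ::
    "bgraph \<Rightarrow> nat set \<Rightarrow> nat set \<Rightarrow> (nat set \<Rightarrow> int) \<Rightarrow> bool" where
  "height_function G M\<^sub>1 M h \<longleftrightarrow>
     (\<forall>f. f \<notin> faces G - {outer G} \<longrightarrow> h f = 0) \<and>
     (\<forall>e\<in>edges G. of_bool (e \<in> M) - of_bool (e \<in> M\<^sub>1) = h (left_face G e) - h (right_face G e))"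

text \<open>
  On a planar graph every \<open>M\<close> has exactly one height function \<open>h\<close>, so this is a sum over the dimer
  configurations.
\<close>

definition face_partition_function ::
    "bgraph \<Rightarrow> (nat \<Rightarrow> complex) \<Rightarrow> nat set \<Rightarrow> complex" where
  "face_partition_function G K M\<^sub>1 =
     (\<Sum>(M, h)\<in>{(M, h). dimer G M \<and> height_function G M\<^sub>1 M h}.
        \<Prod>f\<in>faces G. face_weight G K f powi h f)"

text \<open>
  The edges at which a spider move with black boundary vertices can be performed, \<open>eij\<close> being the
  edge \<open>w\<^sub>i b\<^sub>j\<close>. The face \<open>(w\<^sub>1, b\<^sub>3, w\<^sub>2, b\<^sub>1)\<close> is \<open>{e13, e21}\<close>.
\<close>

definition spider_site :: "bgraph \<Rightarrow> nat \<Rightarrow> nat \<Rightarrow> nat \<Rightarrow> nat \<Rightarrow> nat \<Rightarrow> nat \<Rightarrow> bool" where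
  "spider_site G e11 e12 e13 e21 e23 e24 \<longleftrightarrow>
     {e11, e12, e13, e21, e23, e24} \<subseteq> edges G \<and> distinct [e11, e12, e13, e21, e23, e24] \<and>
     rotW G e11 = e12 \<and> rotW G e12 = e13 \<and> rotW G e13 = e11 \<and>
     rotW G e21 = e23 \<and> rotW G e23 = e24 \<and> rotW G e24 = e21 \<and>
     rotB G e11 = e21 \<and> rotB G e23 = e13 \<and>
     distinct [black_of G e11, black_of G e12, black_of G e13, black_of G e24] \<and>
     outer G \<noteq> {e13, e21}"

text \<open>
  The six edges are kept as labels, but after the move they stand for
  \<open>e11 = w\<^sub>1' b\<^sub>1\<close>, \<open>e13 = w\<^sub>1' b\<^sub>2\<close>, \<open>e24 = w\<^sub>1' b\<^sub>4\<close>, \<open>e12 = w\<^sub>2' b\<^sub>2\<close>, \<open>e23 = w\<^sub>2' b\<^sub>3\<close>, \<open>e21 = w\<^sub>2' b\<^sub>4\<close>.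
  The labels of \<open>w\<^sub>1, w\<^sub>2\<close> are reused for \<open>w\<^sub>1', w\<^sub>2'\<close>. With this labelling \<open>rotB \<circ> rotW\<close> does not change,
  so a face and its counterpart (in particular \<open>outer\<close>) are the same set.
\<close>

definition spider_move ::
    "bgraph \<Rightarrow> nat \<Rightarrow> nat \<Rightarrow> nat \<Rightarrow> nat \<Rightarrow> nat \<Rightarrow> nat \<Rightarrow> bgraph" where
  "spider_move G e11 e12 e13 e21 e23 e24 =
     G\<lparr>white_of := (white_of G)
         (e11 := white_of G e11, e13 := white_of G e11, e24 := white_of G e11,
          e12 := white_of G e21, e23 := white_of G e21, e21 := white_of G e21),
       black_of := (black_of G)(e13 := black_of G e12, e21 := black_of G e24),
       rotW := (rotW G)
         (e11 := e13, e13 := e24, e24 := e11, e12 := e23, e23 := e21, e21 := e12),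
       rotB := (rotB G)
         (e11 := rotB G e21, e12 := e13, e13 := rotB G e12, e23 := rotB G e13,
          e24 := e21, e21 := rotB G e24)\<rparr>"

lemma spider_move_face_rotation:
  assumes "planar_bipartite G" and "spider_site G e11 e12 e13 e21 e23 e24"
  shows "rotB (spider_move G e11 e12 e13 e21 e23 e24) \<circ> rotW (spider_move G e11 e12 e13 e21 e23 e24) =
         rotB G \<circ> rotW G"
proof
  fix x
  let ?G' = "spider_move G e11 e12 e13 e21 e23 e24"
  have site: "rotW G e11 = e12" "rotW G e12 = e13" "rotW G e13 = e11"
    "rotW G e21 = e23" "rotW G e23 = e24" "rotW G e24 = e21"
    "rotB G e11 = e21" "rotB G e23 = e13"
    and neq: "e11 \<noteq> e12" "e11 \<noteq> e13" "e11 \<noteq> e21" "e11 \<noteq> e23" "e11 \<noteq> e24"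
    "e12 \<noteq> e13" "e12 \<noteq> e21" "e12 \<noteq> e23" "e12 \<noteq> e24"
    "e13 \<noteq> e21" "e13 \<noteq> e23" "e13 \<noteq> e24"
    "e21 \<noteq> e23" "e21 \<noteq> e24"
    "e23 \<noteq> e24"
    using assms(2) unfolding spider_site_def by simp_all
  have "rotW G permutes edges G"
    using assms(1) unfolding planar_bipartite_def by (elim conjE)
  then have "inj (rotW G)"
    by (rule permutes_inj)
  then have *: "rotW G x = rotW G y \<longleftrightarrow> x = y" for y
    by (rule inj_eq)
  have "rotW G x \<notin> {e11, e12, e13, e21, e23, e24}"
    if "x \<notin> {e11, e12, e13, e21, e23, e24}"
    using that *[of e11] *[of e12] *[of e13] *[of e21] *[of e23] *[of e24] unfolding site by blast
  then consider "x = e11" | "x = e12" | "x = e13" | "x = e21" | "x = e23" | "x = e24"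
    | "x \<notin> {e11, e12, e13, e21, e23, e24}" "rotW G x \<notin> {e11, e12, e13, e21, e23, e24}"
    by blast
  note cases = this
  have rot: "rotW ?G' = (rotW G)
      (e11 := e13, e13 := e24, e24 := e11, e12 := e23, e23 := e21, e21 := e12)"
    "rotB ?G' = (rotB G)
      (e11 := rotB G e21, e12 := e13, e13 := rotB G e12, e23 := rotB G e13,
       e24 := e21, e21 := rotB G e24)"
    by (cases G, simp only: spider_move_def bgraph.simps)+
  from cases show "(rotB ?G' \<circ> rotW ?G') x = (rotB G \<circ> rotW G) x"
    by cases (simp_all only: rot comp_apply fun_upd_apply site neq neq[symmetric]
        if_False if_True insert_iff empty_iff de_Morgan_disj simp_thms)
qed

text \<open>
  The four train-tracks at the site have parameters \<open>a = \<alpha> e13\<close>, \<open>b = \<alpha> e12\<close>, \<open>c = \<alpha> e23\<close>,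
  \<open>d = \<alpha> e11\<close>, that is \<open>K\<close> is \<open>H(b,d), H(a,b), H(d,a), H(c,b), H(a,c), H(b,a)\<close> on
  \<open>e11, e12, e13, e21, e23, e24\<close>. After the move \<open>K\<close> has to be \<open>H(c,d), H(a,c), H(d,a)\<close> on
  \<open>e11, e13, e24\<close> and \<open>H(c,b), H(d,c), H(b,d)\<close> on \<open>e12, e23, e21\<close>.
\<close>

definition spider_alpha ::
    "(nat \<Rightarrow> complex) \<Rightarrow> nat \<Rightarrow> nat \<Rightarrow> nat \<Rightarrow> nat \<Rightarrow> nat \<Rightarrow> nat \<Rightarrow> nat \<Rightarrow> complex" where
  "spider_alpha \<alpha> e11 e12 e13 e21 e23 e24 =
     (let a = \<alpha> e13; b = \<alpha> e12; c = \<alpha> e23; d = \<alpha> e11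
      in \<alpha>(e11 := d, e13 := c, e24 := a, e12 := b, e23 := c, e21 := d))"

definition spider_beta ::
    "(nat \<Rightarrow> complex) \<Rightarrow> (nat \<Rightarrow> complex) \<Rightarrow> nat \<Rightarrow> nat \<Rightarrow> nat \<Rightarrow> nat \<Rightarrow> nat \<Rightarrow> nat \<Rightarrow> nat \<Rightarrow> complex"
  where
  "spider_beta \<alpha> \<beta> e11 e12 e13 e21 e23 e24 =
     (let a = \<alpha> e13; b = \<alpha> e12; c = \<alpha> e23; d = \<alpha> e11
      in \<beta>(e11 := c, e13 := a, e24 := d, e12 := c, e23 := d, e21 := b))"

definition spider_kasteleyn ::
    "(complex \<Rightarrow> complex \<Rightarrow> complex \<Rightarrow> complex) \<Rightarrow> (nat \<Rightarrow> complex) \<Rightarrow> bgraph \<Rightarrow>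
     (nat \<Rightarrow> complex) \<Rightarrow> (nat \<Rightarrow> complex) \<Rightarrow>
     nat \<Rightarrow> nat \<Rightarrow> nat \<Rightarrow> nat \<Rightarrow> nat \<Rightarrow> nat \<Rightarrow> nat \<Rightarrow> complex" where
  "spider_kasteleyn H t G \<alpha> \<beta> e11 e12 e13 e21 e23 e24 =
     kasteleyn H t (spider_move G e11 e12 e13 e21 e23 e24)
       (spider_alpha \<alpha> e11 e12 e13 e21 e23 e24) (spider_beta \<alpha> \<beta> e11 e12 e13 e21 e23 e24)"

lemma spider_kasteleyn_coefficients:
  fixes H :: "complex \<Rightarrow> complex \<Rightarrow> complex \<Rightarrow> complex"
  assumes "planar_bipartite G" and "spider_site G e11 e12 e13 e21 e23 e24" and "track_parameters G \<alpha> \<beta>"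
    and "t (white_of G e11) = t\<^sub>0" and "t (white_of G e21) = t\<^sub>0"
    and "a = \<alpha> e13" and "b = \<alpha> e12" and "c = \<alpha> e23" and "d = \<alpha> e11"
  defines "K \<equiv> kasteleyn H t G \<alpha> \<beta>"
    and "K' \<equiv> spider_kasteleyn H t G \<alpha> \<beta> e11 e12 e13 e21 e23 e24"
  shows "K e11 = H t\<^sub>0 b d" "K e12 = H t\<^sub>0 a b" "K e13 = H t\<^sub>0 d a"
    "K e21 = H t\<^sub>0 c b" "K e23 = H t\<^sub>0 a c" "K e24 = H t\<^sub>0 b a"
    "K' e11 = H t\<^sub>0 c d" "K' e13 = H t\<^sub>0 a c" "K' e24 = H t\<^sub>0 d a"
    "K' e12 = H t\<^sub>0 c b" "K' e23 = H t\<^sub>0 d c" "K' e21 = H t\<^sub>0 b d"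
    "e \<notin> {e11, e12, e13, e21, e23, e24} \<Longrightarrow> K' e = K e"
proof -
  have site: "distinct [e11, e12, e13, e21, e23, e24]"
    "rotW G e11 = e12" "rotW G e12 = e13" "rotW G e13 = e11"
    "rotW G e21 = e23" "rotW G e23 = e24" "rotW G e24 = e21"
    "rotB G e11 = e21" "rotB G e23 = e13"
    and "{e11, e12, e13, e21, e23, e24} \<subseteq> edges G"
    using assms(2) unfolding spider_site_def by auto
  have "white_of G (rotW G e) = white_of G e" if "e \<in> {e11, e12, e21, e23}" for e
  proof -
    have "e \<in> edges G" "rotW G e \<in> edges G"
      using that site \<open>{e11, e12, e13, e21, e23, e24} \<subseteq> edges G\<close> by auto
    moreover have "rotW G e \<in> orbit (rotW G) e"
      by (rule orbit.base)
    moreover have "\<forall>e\<in>edges G. \<forall>e'\<in>edges G.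
        white_of G e = white_of G e' \<longleftrightarrow> e' \<in> orbit (rotW G) e"
      using assms(1) unfolding planar_bipartite_def by (elim conjE)
    ultimately show ?thesis
      by metis
  qed
  from this[of e11] this[of e12] this[of e21] this[of e23]
  have white: "white_of G e12 = white_of G e11" "white_of G e13 = white_of G e11"
    "white_of G e23 = white_of G e21" "white_of G e24 = white_of G e21"
    using site by simp_all
  have "\<And>e. e \<in> {e11, e12, e13, e21, e23, e24} \<Longrightarrow>
      \<alpha> (rotW G e) = \<beta> e \<and> \<alpha> (rotB G e) = \<beta> e"
    using assms(3) \<open>{e11, e12, e13, e21, e23, e24} \<subseteq> edges G\<close>
    unfolding track_parameters_def by blast
  from this[of e11] this[of e12] this[of e13] this[of e21] this[of e23] this[of e24]
  have track: "\<beta> e11 = b" "\<beta> e12 = a" "\<beta> e13 = d" "\<beta> e21 = c" "\<beta> e23 = a" "\<beta> e24 = b"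
    "\<alpha> e21 = b" "\<alpha> e24 = a"
    using site assms(6-9) by simp_all
  have neq: "e11 \<noteq> e12" "e11 \<noteq> e13" "e11 \<noteq> e21" "e11 \<noteq> e23" "e11 \<noteq> e24"
    "e12 \<noteq> e13" "e12 \<noteq> e21" "e12 \<noteq> e23" "e12 \<noteq> e24"
    "e13 \<noteq> e21" "e13 \<noteq> e23" "e13 \<noteq> e24"
    "e21 \<noteq> e23" "e21 \<noteq> e24"
    "e23 \<noteq> e24"
    using site(1) by simp_all
  have white': "white_of (spider_move G e11 e12 e13 e21 e23 e24) = (white_of G)
         (e11 := white_of G e11, e13 := white_of G e11, e24 := white_of G e11,
          e12 := white_of G e21, e23 := white_of G e21, e21 := white_of G e21)"
    by (cases G) (simp only: spider_move_def bgraph.simps)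
  note defs = K_def K'_def kasteleyn_def spider_kasteleyn_def spider_alpha_def spider_beta_def
    white' Let_def
  show "K e11 = H t\<^sub>0 b d" "K e12 = H t\<^sub>0 a b" "K e13 = H t\<^sub>0 d a"
    "K e21 = H t\<^sub>0 c b" "K e23 = H t\<^sub>0 a c" "K e24 = H t\<^sub>0 b a"
    "K' e11 = H t\<^sub>0 c d" "K' e13 = H t\<^sub>0 a c" "K' e24 = H t\<^sub>0 d a"
    "K' e12 = H t\<^sub>0 c b" "K' e23 = H t\<^sub>0 d c" "K' e21 = H t\<^sub>0 b d"
    "e \<notin> {e11, e12, e13, e21, e23, e24} \<Longrightarrow> K' e = K e"
    unfolding defs
    by (simp_all only: fun_upd_apply neq neq[symmetric] assms(4-9) white track
        if_False if_True simp_thms insert_iff empty_iff de_Morgan_disj)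
qed

text \<open>
  The reference configurations of \<open>G\<close> and \<open>G'\<close> correspond to each other if they agree away from the
  six edges \<open>S\<close> and are determined by what they are there. The last condition excludes only references
  matching \<open>w\<^sub>1, w\<^sub>2\<close> with \<open>b\<^sub>1, b\<^sub>3\<close>, or \<open>w\<^sub>1', w\<^sub>2'\<close> with \<open>b\<^sub>2, b\<^sub>4\<close>. There one configuration of one
  graph corresponds to two configurations of the other, and the partition functions normalised by
  them differ by a factor \<open>1 + \<W>\<^sub>f\<close> or \<open>1 + \<W>\<^sub>f\<inverse>\<close>.
\<close>

definition corresponding_dimers :: "bgraph \<Rightarrow> bgraph \<Rightarrow> nat set \<Rightarrow> nat set \<Rightarrow> nat set \<Rightarrow> bool" where
  "corresponding_dimers G G' S M M' \<longleftrightarrow>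
     dimer G M \<and> dimer G' M' \<and> M - S = M' - S \<and>
     (\<forall>N. dimer G N \<and> N - S = M - S \<longrightarrow> N = M) \<and>
     (\<forall>N. dimer G' N \<and> N - S = M' - S \<longrightarrow> N = M')"

text \<open>Every edge weight occurs in the denominator of a face weight, so all have to be nonzero.\<close>

definition partition_function_invariant ::
    "(complex \<Rightarrow> complex \<Rightarrow> complex \<Rightarrow> complex) \<Rightarrow> bool" where
  "partition_function_invariant H \<longleftrightarrow>
     (\<forall>G t \<alpha> \<beta> e11 e12 e13 e21 e23 e24 M\<^sub>1 M\<^sub>1'.
        let G' = spider_move G e11 e12 e13 e21 e23 e24;
            K = kasteleyn H t G \<alpha> \<beta>;
            K' = spider_kasteleyn H t G \<alpha> \<beta> e11 e12 e13 e21 e23 e24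
        in planar_bipartite G \<and> white_trivalent G \<and> track_parameters G \<alpha> \<beta> \<and>
           spider_site G e11 e12 e13 e21 e23 e24 \<and> t (white_of G e11) = t (white_of G e21) \<and>
           (\<forall>e\<in>edges G. K e \<noteq> 0) \<and> (\<forall>e\<in>edges G'. K' e \<noteq> 0) \<and>
           corresponding_dimers G G' {e11, e12, e13, e21, e23, e24} M\<^sub>1 M\<^sub>1' \<longrightarrow>
           face_partition_function G K M\<^sub>1 = face_partition_function G' K' M\<^sub>1')"

text \<open>
  The rows of \<open>w\<^sub>1', w\<^sub>2'\<close> are obtained from those of \<open>w\<^sub>1, w\<^sub>2\<close> by dividing by \<open>H\<^sub>t(a,b)\<close>, and those of
  \<open>w\<^sub>1, w\<^sub>2\<close> from those of \<open>w\<^sub>1', w\<^sub>2'\<close> by dividing by \<open>H\<^sub>t(c,d)\<close>. These are, up to sign, the weights of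
  \<open>e12\<close> before the move and of \<open>e11\<close> after it. If one of them vanishes, a local rank can drop on one
  side only. The other weights may vanish.
\<close>

definition kernel_invariant :: "(complex \<Rightarrow> complex \<Rightarrow> complex \<Rightarrow> complex) \<Rightarrow> bool" where
  "kernel_invariant H \<longleftrightarrow>
     (\<forall>G t \<alpha> \<beta> e11 e12 e13 e21 e23 e24.
        let G' = spider_move G e11 e12 e13 e21 e23 e24;
            K = kasteleyn H t G \<alpha> \<beta>;
            K' = spider_kasteleyn H t G \<alpha> \<beta> e11 e12 e13 e21 e23 e24
        in planar_bipartite G \<and> white_trivalent G \<and> track_parameters G \<alpha> \<beta> \<and>
           spider_site G e11 e12 e13 e21 e23 e24 \<and> t (white_of G e11) = t (white_of G e21) \<and>
           K e12 \<noteq> 0 \<and> K' e11 \<noteq> 0 \<longrightarrow>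
           kasteleyn_kernel G K = kasteleyn_kernel G' K')"

text \<open>
  Since face weights require nonzero edge weights, the partition function can only see quadruples of
  parameters at which no coefficient vanishes. The following says that the remaining values of
  \<open>H\<close> are limits of such ones. It holds if \<open>H\<^sub>t(a, b) \<noteq> 0\<close> for all \<open>a \<noteq> b\<close>, and also if each \<open>H\<^sub>t\<close> is
  continuous and nonzero on a dense set.
\<close>

definition pair_values ::
    "(complex \<Rightarrow> complex \<Rightarrow> complex \<Rightarrow> complex) \<Rightarrow> complex \<Rightarrow>
     complex \<Rightarrow> complex \<Rightarrow> complex \<Rightarrow> complex \<Rightarrow>
     complex \<times> complex \<times> complex \<times> complex \<times> complex \<times> complex" where
  "pair_values H t a b c d = (H t a b, H t a c, H t a d, H t b c, H t b d, H t c d)"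

definition generically_nonzero :: "(complex \<Rightarrow> complex \<Rightarrow> complex \<Rightarrow> complex) \<Rightarrow> bool" where
  "generically_nonzero H \<longleftrightarrow>
     (\<forall>t a b c d. distinct [a, b, c, d] \<longrightarrow>
        pair_values H t a b c d \<in>
          closure {pair_values H t' a' b' c' d' | t' a' b' c' d'.
            H t' a' b' \<noteq> 0 \<and> H t' a' c' \<noteq> 0 \<and> H t' a' d' \<noteq> 0 \<and>
            H t' b' c' \<noteq> 0 \<and> H t' b' d' \<noteq> 0 \<and> H t' c' d' \<noteq> 0})"

end

theory Submission
  imports Defs
begin

text \<open>
  Fix \<open>t\<close>, suppress it, and write \<open>F(a, b, c, d)\<close> for \<open>H(a,b)H(c,d) + H(a,c)H(d,b) + H(a,d)H(b,c)\<close>. Everything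
  rests on one formula: if \<open>Z\<close> and \<open>Z'\<close> are the partition functions before and after a spider move whose four tracks carry
  \<open>a, b, c, d\<close>, then \<open>Z - Z'\<close> is \<open>F(a, b, c, d)\<close> times an explicit combination of dimer weights
  (\<open>partition_function_defect\<close>).

  The formula comes from linear algebra. In the product of \<open>\<W>\<^sub>f\<close> to the power \<open>h f\<close> over all faces, an
  edge \<open>e\<close> contributes \<open>K e\<close> to the power \<open>h (left) - h (right)\<close>, and this exponent is \<open>1\<close>, \<open>0\<close> or \<open>-1\<close> according
  to whether \<open>e\<close> belongs to \<open>M\<close> and to the reference \<open>M\<^sub>1\<close>. So a dimer configuration weighs \<open>K(M) / K(M\<^sub>1)\<close>
  up to a sign that depends only on the heights (\<open>face_weights_edge_weights\<close>). Now split a configuration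
  into its edges away from the site and the two edges that match \<open>w\<^sub>1\<close> and \<open>w\<^sub>2\<close>. The possible exteriors
  depend only on the pair \<open>T\<close> of black vertices matched with \<open>w\<^sub>1, w\<^sub>2\<close>, and they are the same for both
  graphs. Hence \<open>Z\<close> and \<open>Z'\<close> are, up to normalisation, the sums over \<open>T\<close> of \<open>m\<^sub>T V\<^sub>T\<close> and \<open>m'\<^sub>T V\<^sub>T\<close>, where \<open>m\<^sub>T\<close> and
  \<open>m'\<^sub>T\<close> are, up to sign, the two-by-two minors, in the columns \<open>T\<close>, of the two rows at the site. For
  \<open>\<lambda> = - H(c,d) / H(a,b)\<close> one finds \<open>m'\<^sub>T = \<lambda> m\<^sub>T\<close> when \<open>T\<close> consists of neighbours among \<open>b\<^sub>1, b\<^sub>2, b\<^sub>3, b\<^sub>4\<close>,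
  whereas \<open>m'\<^sub>1\<^sub>3 - \<lambda> m\<^sub>1\<^sub>3 = \<lambda> F\<close> and \<open>m'\<^sub>2\<^sub>4 - \<lambda> m\<^sub>2\<^sub>4 = - F\<close>. Since corresponding references have the
  same neighbouring \<open>T\<close>, the factor \<open>\<lambda>\<close> cancels against the normalisation and only multiples of \<open>F\<close> remain.

  If \<open>F\<close> vanishes, this gives the invariance of the partition function. The same vanishing makes the two
  rows of \<open>G'\<close>, multiplied by \<open>H(a,b)\<close>, linear combinations of those of \<open>G\<close>, and the rows of \<open>G\<close>, multiplied by
  \<open>H(c,d)\<close>, linear combinations of those of \<open>G'\<close>. So the kernels agree when both factors are nonzero
  (\<open>kernel_move\<close>).

  For the converse one graph suffices, the cube. Its four train-tracks all pass through the site, so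
  their parameters are free, and the combination of dimer weights in the formula is itself a nonzero multiple
  of \<open>F\<close>. Thus \<open>Z - Z'\<close> is a nonzero multiple of the square of \<open>F\<close>, and invariance forces
  \<open>F = 0\<close> whenever the six values of \<open>H\<close> are nonzero. The relation is closed, so it extends to all distinct
  parameters by the genericity of \<open>H\<close>; for repeated parameters it follows from antisymmetry.
\<close>

section \<open>Orbits of short cycles\<close>

lemma orbit_subset_of_closed:
  assumes "p x \<in> A" and "\<And>y. y \<in> A \<Longrightarrow> p y \<in> A"
  shows "orbit p x \<subseteq> A"
proof
  show "y \<in> A" if "y \<in> orbit p x" for y
    using that by induct (use assms in auto)
qed

lemma orbit_two_cycle:
  assumes "p (p x) = x"
  shows "orbit p x = {x, p x}"
proof
  show "orbit p x \<subseteq> {x, p x}"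
    by (rule orbit_subset_of_closed) (use assms in auto)
  have "p x \<in> orbit p x" "p (p x) \<in> orbit p x"
    by (auto intro: orbit.intros)
  then show "{x, p x} \<subseteq> orbit p x"
    unfolding assms by blast
qed

lemma orbit_three_cycle:
  assumes "p (p (p x)) = x"
  shows "orbit p x = {x, p x, p (p x)}"
proof
  show "orbit p x \<subseteq> {x, p x, p (p x)}"
    by (rule orbit_subset_of_closed) (use assms in auto)
  have "p x \<in> orbit p x" "p (p x) \<in> orbit p x" "p (p (p x)) \<in> orbit p x"
    by (auto intro: orbit.intros)
  then show "{x, p x, p (p x)} \<subseteq> orbit p x"
    unfolding assms by blast
qed

section \<open>From face weights to edge weights\<close>

text \<open>
  The part of the product of the face weights that comes from their signs \<open>(- 1) ^ (n + 1)\<close>.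
\<close>

definition face_sign :: "nat set set \<Rightarrow> (nat set \<Rightarrow> int) \<Rightarrow> complex" where
  "face_sign \<F> h = (\<Prod>F\<in>\<F>. ((- 1) ^ (card F + 1)) powi h F)"

lemma prod_powi:
  fixes g :: "'a \<Rightarrow> 'b::field"
  shows "(\<Prod>x\<in>A. g x) powi n = (\<Prod>x\<in>A. g x powi n)"
  by (induction A rule: infinite_finite_induct) (auto simp: power_int_mult_distrib)

text \<open>
  Raising the product over each fibre of \<open>p\<close> to a power attached to that fibre amounts to giving each
  element the exponent of its own fibre. With \<open>p\<close> the left or the right face, this passes from faces to edges.
\<close>

lemma prod_powi_fibres:
  fixes g :: "'a \<Rightarrow> 'b::field"
  assumes "finite E" and "finite \<F>" and "p ` E \<subseteq> \<F>"
  shows "(\<Prod>F\<in>\<F>. (\<Prod>e | e \<in> E \<and> p e = F. g e) powi h F) = (\<Prod>e\<in>E. g e powi h (p e))"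
proof -
  have "(\<Prod>e | e \<in> E \<and> p e = F. g e) powi h F = (\<Prod>e | e \<in> E \<and> p e = F. g e powi h (p e))" for F
    unfolding prod_powi by (rule prod.cong) auto
  then show ?thesis
    using prod.group[OF assms, of "\<lambda>e. g e powi h (p e)"] by simp
qed

lemma prod_of_bool_powi:
  fixes g :: "'a \<Rightarrow> 'b::field"
  assumes "finite E" and "M \<subseteq> E"
  shows "(\<Prod>e\<in>E. g e powi of_bool (e \<in> M)) = (\<Prod>e\<in>M. g e)"
proof -
  have "(\<Prod>e\<in>E. g e powi of_bool (e \<in> M)) = (\<Prod>e\<in>E. if e \<in> M then g e else 1)"
    by (rule prod.cong) auto
  also have "\<dots> = (\<Prod>e\<in>M. g e)"
    using assms by (simp add: prod.inter_restrict[symmetric] Int_absorb1)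
  finally show ?thesis .
qed

text \<open>
  Each edge occurs once in a numerator, that of its left face, and once in a denominator, that of its right
  face. So the exponent of \<open>K e\<close> is the jump of the height across \<open>e\<close>, which by definition of the height function
  is \<open>1\<close> on \<open>M - M\<^sub>1\<close>, \<open>- 1\<close> on \<open>M\<^sub>1 - M\<close> and \<open>0\<close> elsewhere.
\<close>

lemma face_weights_edge_weights:
  assumes fin: "finite (edges G)" and rot: "\<And>e. e \<in> edges G \<Longrightarrow> rotB G e \<in> edges G"
    and nz: "\<And>e. e \<in> edges G \<Longrightarrow> K e \<noteq> 0"
    and M: "M \<subseteq> edges G" "M\<^sub>1 \<subseteq> edges G"
    and h: "height_function G M\<^sub>1 M h"
  shows "(\<Prod>F\<in>faces G. face_weight G K F powi h F) =
         face_sign (faces G) h * ((\<Prod>e\<in>M. K e) / (\<Prod>e\<in>M\<^sub>1. K e))"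
proof -
  have finF: "finite (faces G)"
    using fin by (simp add: faces_def)
  have left: "left_face G ` edges G \<subseteq> faces G"
    by (simp add: faces_def)
  have right: "right_face G ` edges G \<subseteq> faces G"
    using rot by (auto simp: faces_def right_face_def)
  have "(\<Prod>F\<in>faces G. face_weight G K F powi h F) =
        face_sign (faces G) h * ((\<Prod>e\<in>edges G. K e powi h (left_face G e)) /
          (\<Prod>e\<in>edges G. K e powi h (right_face G e)))"
    unfolding prod_powi_fibres[OF fin finF left, symmetric]
      prod_powi_fibres[OF fin finF right, symmetric]
    by (simp only: face_sign_def face_weight_def power_int_mult_distrib power_int_divide_distrib
        prod.distrib prod_dividef)
  also have "(\<Prod>e\<in>edges G. K e powi h (left_face G e)) / (\<Prod>e\<in>edges G. K e powi h (right_face G e)) =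
        (\<Prod>e\<in>edges G. K e powi (h (left_face G e) - h (right_face G e)))"
    unfolding prod_dividef[symmetric] by (rule prod.cong) (auto simp: power_int_diff nz)
  also have "\<dots> = (\<Prod>e\<in>edges G. K e powi (of_bool (e \<in> M) - of_bool (e \<in> M\<^sub>1)))"
    using h by (intro prod.cong) (auto simp: height_function_def)
  also have "\<dots> = (\<Prod>e\<in>edges G. K e powi of_bool (e \<in> M)) / (\<Prod>e\<in>edges G. K e powi of_bool (e \<in> M\<^sub>1))"
    unfolding prod_dividef[symmetric] by (rule prod.cong) (auto simp: power_int_diff nz)
  finally show ?thesis
    by (simp only: prod_of_bool_powi[OF fin M(1)] prod_of_bool_powi[OF fin M(2)])
qed

lemma left_face_rot:
  assumes "finite (edges G)" "rotW G permutes edges G" "rotB G permutes edges G"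
  shows "left_face G (rotB G (rotW G e)) = left_face G e" and "e \<in> left_face G e"
proof -
  have "rotB G \<circ> rotW G permutes edges G"
    using assms by (intro permutes_compose)
  then have p: "permutation (rotB G \<circ> rotW G)"
    using assms(1) permutation_permutes by blast
  then show 2: "e \<in> left_face G e"
    unfolding left_face_def by (rule permutation_self_in_orbit)
  show "left_face G (rotB G (rotW G e)) = left_face G e"
    using permutation_orbit_step[OF p, of e] by (simp add: left_face_def)
qed

text \<open>Heights\<close>
text \<open>
  The difference of two height functions takes equal values on the two sides of every edge. The edges whose
  left face has the value of the unbounded face are therefore closed under both rotations, and connectedness
  makes them all the edges.
\<close>

lemma height_function_unique:
  assumes G: "planar_bipartite G" and h: "height_function G M\<^sub>1 M h" and h': "height_function G M\<^sub>1 M h'"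
  shows "h = h'"
proof -
  have fin: "finite (edges G)" and W: "rotW G permutes edges G" and B: "rotB G permutes edges G"
    and conn: "\<And>A. A \<subseteq> edges G \<Longrightarrow> A \<noteq> {} \<Longrightarrow> rotW G ` A \<subseteq> A \<Longrightarrow> rotB G ` A \<subseteq> A \<Longrightarrow> A = edges G"
    and out: "outer G \<in> faces G"
    using G unfolding planar_bipartite_def by blast+
  define d where "d F = h F - h' F" for F
  have d: "d (left_face G (rotB G e)) = d (left_face G e)" if "e \<in> edges G" for e
    using h h' that unfolding height_function_def d_def right_face_def by (smt (verit))
  have out0: "d (outer G) = 0"
    using h h' unfolding height_function_def d_def by auto
  obtain e\<^sub>0 where e0: "e\<^sub>0 \<in> edges G" "outer G = left_face G e\<^sub>0"
    using out by (auto simp: faces_def)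
  define A where "A = {e \<in> edges G. d (left_face G e) = 0}"
  have "A = edges G"
  proof (rule conn)
    show "A \<noteq> {}"
      using e0 out0 by (auto simp: A_def)
    show "rotB G ` A \<subseteq> A"
      using d permutes_in_image[OF B] by (auto simp: A_def)
    show "rotW G ` A \<subseteq> A"
      using d permutes_in_image[OF W] left_face_rot(1)[OF fin W B] by (force simp: A_def)
  qed (auto simp: A_def)
  then have "d F = 0" if "F \<in> faces G" for F
    using that by (auto simp: A_def faces_def)
  moreover have "d F = 0" if "F \<notin> faces G" for F
    using h h' that unfolding height_function_def d_def by auto
  ultimately show ?thesis
    unfolding d_def by (metis eq_iff_diff_eq_0 ext)
qed

text \<open>
  The partition function is a sum over pairs; finiteness ensures that it is not the default value of an
  infinite sum.
\<close>

lemma finite_dimer_heights: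
  assumes "planar_bipartite G"
  shows "finite {(M, h). dimer G M \<and> height_function G M\<^sub>1 M h}" (is "finite ?P")
proof (rule inj_on_finite[of fst _ "Pow (edges G)"])
  show "inj_on fst ?P"
    by (rule inj_onI) (auto dest: height_function_unique[OF assms])
  show "fst ` ?P \<subseteq> Pow (edges G)"
    by (auto simp: dimer_def)
  show "finite (Pow (edges G))"
    using assms by (simp add: planar_bipartite_def)
qed

section \<open>The neighbourhood of a spider move\<close>

lemma ex1_insert_iff:
  assumes "x \<notin> A"
  shows "(\<exists>!e. e \<in> insert x A \<and> P e) \<longleftrightarrow> (if P x then \<forall>e\<in>A. \<not> P e else \<exists>!e. e \<in> A \<and> P e)"
proof (cases "P x")
  case True
  then show ?thesis
    using assms by (auto simp: Ex1_def)
next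
  case False
  then have "e \<in> insert x A \<and> P e \<longleftrightarrow> e \<in> A \<and> P e" for e
    by auto
  then show ?thesis
    using False by simp
qed

lemma ball_exempt_two: "(\<forall>w\<in>A. w = a \<or> w = b \<or> P w) \<longleftrightarrow> (\<forall>w\<in>A - {a, b}. P w)"
  by auto

lemma ball_if_two:
  assumes "{c, d} \<subseteq> B"
  shows "(\<forall>b\<in>B. if b = c \<or> b = d then P b else Q b) \<longleftrightarrow> (\<forall>b\<in>{c, d}. P b) \<and> (\<forall>b\<in>B - {c, d}. Q b)"
  using assms by auto

text \<open>
  What a planar graph with a site and, under other labels, the graph after the move have in common, so that
  the lemmas on a site apply to both.
\<close>

locale spider_region =
  fixes G :: bgraph and e11 e12 e13 e21 e23 e24 :: nat
  assumes finite_edges: "finite (edges G)"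
    and rotW_permutes: "rotW G permutes edges G"
    and rotB_permutes: "rotB G permutes edges G"
    and site: "spider_site G e11 e12 e13 e21 e23 e24"
    and edges_w1: "{e \<in> edges G. white_of G e = white_of G e11} = {e11, e12, e13}"
    and edges_w2: "{e \<in> edges G. white_of G e = white_of G e21} = {e21, e23, e24}"
    and black_shared: "black_of G e21 = black_of G e11" "black_of G e23 = black_of G e13"
begin

abbreviation "S \<equiv> {e11, e12, e13, e21, e23, e24}"
abbreviation "w\<^sub>1 \<equiv> white_of G e11"
abbreviation "w\<^sub>2 \<equiv> white_of G e21"
abbreviation "b\<^sub>1 \<equiv> black_of G e11"
abbreviation "b\<^sub>2 \<equiv> black_of G e12"
abbreviation "b\<^sub>3 \<equiv> black_of G e13"
abbreviation "b\<^sub>4 \<equiv> black_of G e24"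
abbreviation "f \<equiv> {e13, e21}"
abbreviation "f\<^sub>1 \<equiv> left_face G e11"
abbreviation "f\<^sub>2 \<equiv> left_face G e12"
abbreviation "f\<^sub>3 \<equiv> left_face G e23"
abbreviation "f\<^sub>4 \<equiv> left_face G e24"

lemma site_edges: "S \<subseteq> edges G"
  using site by (simp add: spider_site_def)

lemma site_distinct:
  "e11 \<noteq> e12" "e11 \<noteq> e13" "e11 \<noteq> e21" "e11 \<noteq> e23" "e11 \<noteq> e24"
  "e12 \<noteq> e11" "e12 \<noteq> e13" "e12 \<noteq> e21" "e12 \<noteq> e23" "e12 \<noteq> e24"
  "e13 \<noteq> e11" "e13 \<noteq> e12" "e13 \<noteq> e21" "e13 \<noteq> e23" "e13 \<noteq> e24"
  "e21 \<noteq> e11" "e21 \<noteq> e12" "e21 \<noteq> e13" "e21 \<noteq> e23" "e21 \<noteq> e24"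
  "e23 \<noteq> e11" "e23 \<noteq> e12" "e23 \<noteq> e13" "e23 \<noteq> e21" "e23 \<noteq> e24"
  "e24 \<noteq> e11" "e24 \<noteq> e12" "e24 \<noteq> e13" "e24 \<noteq> e21" "e24 \<noteq> e23"
proof -
  have "distinct [e11, e12, e13, e21, e23, e24]"
    using site unfolding spider_site_def by (elim conjE)
  then show "e11 \<noteq> e12" "e11 \<noteq> e13" "e11 \<noteq> e21" "e11 \<noteq> e23" "e11 \<noteq> e24"
    "e12 \<noteq> e11" "e12 \<noteq> e13" "e12 \<noteq> e21" "e12 \<noteq> e23" "e12 \<noteq> e24"
    "e13 \<noteq> e11" "e13 \<noteq> e12" "e13 \<noteq> e21" "e13 \<noteq> e23" "e13 \<noteq> e24"
    "e21 \<noteq> e11" "e21 \<noteq> e12" "e21 \<noteq> e13" "e21 \<noteq> e23" "e21 \<noteq> e24"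
    "e23 \<noteq> e11" "e23 \<noteq> e12" "e23 \<noteq> e13" "e23 \<noteq> e21" "e23 \<noteq> e24"
    "e24 \<noteq> e11" "e24 \<noteq> e12" "e24 \<noteq> e13" "e24 \<noteq> e21" "e24 \<noteq> e23"
    by auto
qed

lemma site_rot:
  "rotW G e11 = e12" "rotW G e12 = e13" "rotW G e13 = e11"
  "rotW G e21 = e23" "rotW G e23 = e24" "rotW G e24 = e21"
  "rotB G e11 = e21" "rotB G e23 = e13"
  using site unfolding spider_site_def by simp_all

lemma site_whites: "white_of G e12 = w\<^sub>1" "white_of G e13 = w\<^sub>1" "white_of G e23 = w\<^sub>2" "white_of G e24 = w\<^sub>2"
  "w\<^sub>1 \<noteq> w\<^sub>2" "w\<^sub>2 \<noteq> w\<^sub>1"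
  using edges_w1 edges_w2 site_distinct by auto

lemma site_edge_iff: "e \<in> S \<longleftrightarrow> e \<in> edges G \<and> white_of G e \<in> {w\<^sub>1, w\<^sub>2}"
  using edges_w1 edges_w2 by blast

lemma site_blacks: "b\<^sub>1 \<noteq> b\<^sub>2" "b\<^sub>1 \<noteq> b\<^sub>3" "b\<^sub>1 \<noteq> b\<^sub>4" "b\<^sub>2 \<noteq> b\<^sub>1" "b\<^sub>2 \<noteq> b\<^sub>3" "b\<^sub>2 \<noteq> b\<^sub>4"
  "b\<^sub>3 \<noteq> b\<^sub>1" "b\<^sub>3 \<noteq> b\<^sub>2" "b\<^sub>3 \<noteq> b\<^sub>4" "b\<^sub>4 \<noteq> b\<^sub>1" "b\<^sub>4 \<noteq> b\<^sub>2" "b\<^sub>4 \<noteq> b\<^sub>3"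
proof -
  have "distinct [b\<^sub>1, b\<^sub>2, b\<^sub>3, b\<^sub>4]"
    using site unfolding spider_site_def by (elim conjE)
  then show "b\<^sub>1 \<noteq> b\<^sub>2" "b\<^sub>1 \<noteq> b\<^sub>3" "b\<^sub>1 \<noteq> b\<^sub>4" "b\<^sub>2 \<noteq> b\<^sub>1" "b\<^sub>2 \<noteq> b\<^sub>3" "b\<^sub>2 \<noteq> b\<^sub>4"
    "b\<^sub>3 \<noteq> b\<^sub>1" "b\<^sub>3 \<noteq> b\<^sub>2" "b\<^sub>3 \<noteq> b\<^sub>4" "b\<^sub>4 \<noteq> b\<^sub>1" "b\<^sub>4 \<noteq> b\<^sub>2" "b\<^sub>4 \<noteq> b\<^sub>3"
    by auto
qed

lemma left_face_rot': "left_face G (rotB G (rotW G e)) = left_face G e"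
  and in_left_face: "e \<in> left_face G e"
  using left_face_rot[OF finite_edges rotW_permutes rotB_permutes] by blast+

lemma left_face_site: "left_face G e13 = f" "left_face G e21 = f"
proof -
  have "(rotB G \<circ> rotW G) e13 = e21" "(rotB G \<circ> rotW G) e21 = e13"
    by (simp_all add: site_rot)
  then show "left_face G e13 = f"
    unfolding left_face_def using orbit_two_cycle[of "rotB G \<circ> rotW G" e13] by simp
  then show "left_face G e21 = f"
    using left_face_rot'[of e13] by (simp add: site_rot)
qed

lemma left_face_eq_f_iff: "left_face G e = f \<longleftrightarrow> e \<in> f"
  using in_left_face left_face_site by auto

lemma right_face_site:
  "right_face G e11 = f" "right_face G e12 = f\<^sub>1" "right_face G e13 = f\<^sub>2"
  "right_face G e21 = f\<^sub>4" "right_face G e23 = f" "right_face G e24 = f\<^sub>3"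
  using left_face_rot'[of e11] left_face_rot'[of e12] left_face_rot'[of e23] left_face_rot'[of e24]
  by (simp_all add: right_face_def site_rot left_face_site)

text \<open>
  The two edges on the right of which \<open>f\<close> lies are \<open>e11\<close> and \<open>e23\<close>, since the rotation at the black
  vertices is injective. So away from the site no height equation involves \<open>h f\<close>.
\<close>

lemma right_face_eq_f: "right_face G e = f \<Longrightarrow> e \<in> S"
proof -
  assume "right_face G e = f"
  then have "rotB G e = rotB G e11 \<or> rotB G e = rotB G e23"
    unfolding right_face_def left_face_eq_f_iff by (auto simp: site_rot)
  then show "e \<in> S"
    using permutes_inj[OF rotB_permutes] by (auto dest: injD)
qed

lemma f_face: "f \<in> faces G" "f \<noteq> outer G"
  using site_edges left_face_site site unfolding faces_def spider_site_def by auto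

lemma finite_faces: "finite (faces G)"
  using finite_edges by (simp add: faces_def)

lemma site_faces_neq_f: "f\<^sub>1 \<noteq> f" "f\<^sub>2 \<noteq> f" "f\<^sub>3 \<noteq> f" "f\<^sub>4 \<noteq> f"
  unfolding left_face_eq_f_iff using site_distinct by auto

text \<open>
  The possible ways to match \<open>w\<^sub>1\<close> and \<open>w\<^sub>2\<close>, the edge at \<open>w\<^sub>1\<close> first: all nine choices but the two that use \<open>b\<^sub>1\<close>
  or \<open>b\<^sub>3\<close> twice.
\<close>

definition local_pairs :: "(nat \<times> nat) set" where
  "local_pairs = {(e12, e21), (e11, e24), (e12, e23), (e13, e24), (e11, e23), (e13, e21), (e12, e24)}"

definition pair_type :: "nat \<times> nat \<Rightarrow> nat set" where
  "pair_type p = {black_of G (fst p), black_of G (snd p)}"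

text \<open>
  The edges off the site of a dimer configuration that matches \<open>w\<^sub>1\<close> and \<open>w\<^sub>2\<close> with the black vertices \<open>T\<close>.
\<close>

definition exterior_dimer :: "nat set \<Rightarrow> nat set \<Rightarrow> bool" where
  "exterior_dimer T N \<longleftrightarrow>
     N \<subseteq> edges G - S \<and>
     (\<forall>w\<in>whites G - {w\<^sub>1, w\<^sub>2}. \<exists>!e. e \<in> N \<and> white_of G e = w) \<and>
     (\<forall>b\<in>T. \<forall>e\<in>N. black_of G e \<noteq> b) \<and>
     (\<forall>b\<in>blacks G - T. \<exists>!e. e \<in> N \<and> black_of G e = b)"

lemma local_pairs_cases:
  assumes "x \<in> {e11, e12, e13}" and "y \<in> {e21, e23, e24}" and "black_of G x \<noteq> black_of G y"
  shows "(x, y) \<in> local_pairs"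
  using assms black_shared by (auto simp: local_pairs_def)

lemma local_pairsD:
  assumes "(x, y) \<in> local_pairs"
  shows "x \<in> {e11, e12, e13}" "y \<in> {e21, e23, e24}" "black_of G x \<noteq> black_of G y"
    "white_of G x = w\<^sub>1" "white_of G y = w\<^sub>2" "x \<noteq> y" "x \<in> S" "y \<in> S"
  using assms site_whites site_blacks site_distinct by (auto simp: local_pairs_def black_shared)

lemma dimer_local_pair:
  assumes "dimer G M"
  obtains x y where "(x, y) \<in> local_pairs" and "M \<inter> S = {x, y}"
proof -
  have M: "M \<subseteq> edges G" and w: "\<And>w. w \<in> whites G \<Longrightarrow> \<exists>!e. e \<in> M \<and> white_of G e = w"
    and b: "\<And>b. b \<in> blacks G \<Longrightarrow> \<exists>!e. e \<in> M \<and> black_of G e = b"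
    using assms unfolding dimer_def by auto
  have "w\<^sub>1 \<in> whites G" "w\<^sub>2 \<in> whites G"
    using site_edges by (auto simp: whites_def)
  then have "\<exists>!e. e \<in> M \<and> white_of G e = w\<^sub>1" "\<exists>!e. e \<in> M \<and> white_of G e = w\<^sub>2"
    using w by blast+
  then obtain x y where x: "x \<in> M" "white_of G x = w\<^sub>1" "\<And>e. e \<in> M \<Longrightarrow> white_of G e = w\<^sub>1 \<Longrightarrow> e = x"
    and y: "y \<in> M" "white_of G y = w\<^sub>2" "\<And>e. e \<in> M \<Longrightarrow> white_of G e = w\<^sub>2 \<Longrightarrow> e = y"
    by (elim ex1E) blast
  have "x \<noteq> y"
    using x(2) y(2) site_whites(5) by auto
  have "black_of G x \<in> blacks G"
    using x(1) M by (auto simp: blacks_def)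
  then have "\<exists>!e. e \<in> M \<and> black_of G e = black_of G x"
    by (rule b)
  then have "black_of G x \<noteq> black_of G y"
    using x(1) y(1) \<open>x \<noteq> y\<close> by (elim ex1E) metis
  moreover have "x \<in> {e11, e12, e13}"
    using x(1,2) M unfolding edges_w1[symmetric] by blast
  moreover have "y \<in> {e21, e23, e24}"
    using y(1,2) M unfolding edges_w2[symmetric] by blast
  ultimately have "(x, y) \<in> local_pairs"
    using local_pairs_cases by blast
  moreover have "M \<inter> S = {x, y}"
  proof (intro equalityI subsetI)
    fix e assume "e \<in> M \<inter> S"
    then have "e \<in> M" "white_of G e = w\<^sub>1 \<or> white_of G e = w\<^sub>2"
      using site_edge_iff by blast+
    then show "e \<in> {x, y}"
      using x(3) y(3) by blast
  next
    fix e assume "e \<in> {x, y}"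
    then show "e \<in> M \<inter> S"
      using x(1,2) y(1,2) M site_edge_iff[of e] by blast
  qed
  ultimately show thesis
    using that by blast
qed

lemma dimer_iff_exterior:
  assumes xy: "(x, y) \<in> local_pairs" and N: "N \<inter> S = {}"
  shows "dimer G (N \<union> {x, y}) \<longleftrightarrow> exterior_dimer (pair_type (x, y)) N"
proof -
  note xy' = local_pairsD[OF xy]
  have xyE: "x \<in> edges G" "y \<in> edges G"
    using xy' site_edges by auto
  have Nw: "e \<in> N \<Longrightarrow> white_of G e \<noteq> w\<^sub>1 \<and> white_of G e \<noteq> w\<^sub>2" if "N \<subseteq> edges G" for e
    using that N site_edge_iff by blast
  have ins: "N \<union> {x, y} = insert x (insert y N)" "x \<notin> insert y N" "y \<notin> N"
    using N xy'(6,7,8) by auto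
  have wh: "(\<exists>!e. e \<in> N \<union> {x, y} \<and> white_of G e = w) \<longleftrightarrow>
      w = w\<^sub>1 \<or> w = w\<^sub>2 \<or> (\<exists>!e. e \<in> N \<and> white_of G e = w)" if "N \<subseteq> edges G" for w
    unfolding ins(1) ex1_insert_iff[OF ins(2)] ex1_insert_iff[OF ins(3)] xy'(4,5)
    using Nw[OF that] site_whites(5,6) xy'(4,5) by auto
  have bl: "(\<exists>!e. e \<in> N \<union> {x, y} \<and> black_of G e = b) \<longleftrightarrow>
      (if b = black_of G x \<or> b = black_of G y then \<forall>e\<in>N. black_of G e \<noteq> b
       else \<exists>!e. e \<in> N \<and> black_of G e = b)" for b
    unfolding ins(1) ex1_insert_iff[OF ins(2)] ex1_insert_iff[OF ins(3)]
    using xy'(3) by auto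
  have T: "pair_type (x, y) \<subseteq> blacks G"
    using xyE by (auto simp: pair_type_def blacks_def)
  show ?thesis
  proof (cases "N \<subseteq> edges G")
    case True
    have W: "(\<forall>w\<in>whites G. \<exists>!e. e \<in> N \<union> {x, y} \<and> white_of G e = w) \<longleftrightarrow>
        (\<forall>w\<in>whites G - {w\<^sub>1, w\<^sub>2}. \<exists>!e. e \<in> N \<and> white_of G e = w)"
      unfolding wh[OF True] by (rule ball_exempt_two)
    have B: "(\<forall>b\<in>blacks G. \<exists>!e. e \<in> N \<union> {x, y} \<and> black_of G e = b) \<longleftrightarrow>
        (\<forall>b\<in>pair_type (x, y). \<forall>e\<in>N. black_of G e \<noteq> b) \<and>
        (\<forall>b\<in>blacks G - pair_type (x, y). \<exists>!e. e \<in> N \<and> black_of G e = b)"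
      unfolding bl pair_type_def fst_conv snd_conv
      by (rule ball_if_two) (use T in \<open>simp add: pair_type_def\<close>)
    have E: "N \<union> {x, y} \<subseteq> edges G" "N \<subseteq> edges G - S"
      using True N xyE by auto
    show ?thesis
      unfolding dimer_def exterior_dimer_def W B by (simp only: E simp_thms)
  next
    case False
    then show ?thesis
      unfolding dimer_def exterior_dimer_def by auto
  qed
qed

text \<open>
  The trace of a height function on the faces other than \<open>f\<close>, where \<open>N\<^sub>1\<close> and \<open>T\<^sub>1\<close> are the exterior and the type of
  the reference. The value at \<open>f\<close> is set to \<open>0\<close>, which makes the trace unique. The last four
  equations give the jump of the height between two consecutive outer faces: crossing all site edges at \<open>b\<^sub>i\<close>
  changes it by \<open>1\<close> for each of the two configurations, with opposite signs, that uses one of these edges.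
\<close>

definition exterior_height ::
    "nat set \<Rightarrow> nat set \<Rightarrow> nat set \<Rightarrow> nat set \<Rightarrow> (nat set \<Rightarrow> int) \<Rightarrow> bool" where
  "exterior_height N\<^sub>1 T\<^sub>1 T N g \<longleftrightarrow>
     (\<forall>F. F \<notin> faces G - {outer G} \<longrightarrow> g F = 0) \<and> g f = 0 \<and>
     (\<forall>e\<in>edges G - S. of_bool (e \<in> N) - of_bool (e \<in> N\<^sub>1) = g (left_face G e) - g (right_face G e)) \<and>
     g f\<^sub>1 - g f\<^sub>4 = of_bool (b\<^sub>1 \<in> T) - of_bool (b\<^sub>1 \<in> T\<^sub>1) \<and>
     g f\<^sub>2 - g f\<^sub>1 = of_bool (b\<^sub>2 \<in> T) - of_bool (b\<^sub>2 \<in> T\<^sub>1) \<and>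
     g f\<^sub>3 - g f\<^sub>2 = of_bool (b\<^sub>3 \<in> T) - of_bool (b\<^sub>3 \<in> T\<^sub>1) \<and>
     g f\<^sub>4 - g f\<^sub>3 = of_bool (b\<^sub>4 \<in> T) - of_bool (b\<^sub>4 \<in> T\<^sub>1)"

definition exterior :: "nat set \<Rightarrow> nat set \<Rightarrow> nat set \<Rightarrow> (nat set \<times> (nat set \<Rightarrow> int)) set" where
  "exterior N\<^sub>1 T\<^sub>1 T = {(N, g). exterior_dimer T N \<and> exterior_height N\<^sub>1 T\<^sub>1 T N g}"

text \<open>
  The height of \<open>f\<close>, read off from the equation at \<open>e13\<close>, which separates \<open>f\<close> from \<open>f\<^sub>2\<close>.
\<close>

definition inner_height :: "nat \<times> nat \<Rightarrow> nat \<times> nat \<Rightarrow> (nat set \<Rightarrow> int) \<Rightarrow> int" where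
  "inner_height p\<^sub>1 p g = g f\<^sub>2 + of_bool (fst p = e13) - of_bool (fst p\<^sub>1 = e13)"

lemma local_pair_indicators:
  fixes i :: "nat \<Rightarrow> int"
  assumes p: "(x, y) \<in> local_pairs" and i: "\<And>e. i e = of_bool (e = x \<or> e = y)"
  shows "i e11 + i e12 + i e13 = 1" "i e21 + i e23 + i e24 = 1" "i e13 = of_bool (x = e13)"
    "of_bool (b\<^sub>1 \<in> pair_type (x, y)) = i e11 + i e21" "of_bool (b\<^sub>2 \<in> pair_type (x, y)) = i e12"
    "of_bool (b\<^sub>3 \<in> pair_type (x, y)) = i e13 + i e23" "of_bool (b\<^sub>4 \<in> pair_type (x, y)) = i e24"
  using p unfolding local_pairs_def insert_iff prod.inject empty_iff
  by (elim disjE conjE FalseE;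
      simp add: i site_distinct pair_type_def site_blacks black_shared)+

text \<open>
  Six equations at the site involve the five values at \<open>f, f\<^sub>1, f\<^sub>2, f\<^sub>3, f\<^sub>4\<close>. Since exactly one of the three edges at
  each white vertex is used, they are equivalent to the four jumps between outer faces and to the formula for
  \<open>h f\<close>.
\<close>

lemma height_function_iff_exterior:
  assumes p: "(x, y) \<in> local_pairs" and p1: "(x\<^sub>1, y\<^sub>1) \<in> local_pairs"
    and N: "N \<inter> S = {}" "N\<^sub>1 \<inter> S = {}"
  shows "height_function G (N\<^sub>1 \<union> {x\<^sub>1, y\<^sub>1}) (N \<union> {x, y}) h \<longleftrightarrow>
    exterior_height N\<^sub>1 (pair_type (x\<^sub>1, y\<^sub>1)) (pair_type (x, y)) N (h(f := 0)) \<and>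
    h f = inner_height (x\<^sub>1, y\<^sub>1) (x, y) h"
proof -
  note xy = local_pairsD[OF p] local_pairsD[OF p1]
  define i j :: "nat \<Rightarrow> int" where "i e = of_bool (e = x \<or> e = y)" and "j e = of_bool (e = x\<^sub>1 \<or> e = y\<^sub>1)" for e
  note I = local_pair_indicators[OF p, of i, OF i_def] local_pair_indicators[OF p1, of j, OF j_def]
  let ?rest = "\<lambda>h. \<forall>e\<in>edges G - S.
    of_bool (e \<in> N) - of_bool (e \<in> N\<^sub>1) = h (left_face G e) - (h (right_face G e) :: int)"
  let ?support = "\<lambda>h. \<forall>F. F \<notin> faces G - {outer G} \<longrightarrow> h F = (0 :: int)"
  have split: "(\<forall>e\<in>edges G. Q e) \<longleftrightarrow> (\<forall>e\<in>edges G - S. Q e) \<and> (\<forall>e\<in>S. Q e)" for Q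
    using site_edges by blast
  have on_S: "of_bool (e \<in> N \<union> {x, y}) = i e" "of_bool (e \<in> N\<^sub>1 \<union> {x\<^sub>1, y\<^sub>1}) = j e"
    if "e \<in> S" for e
    using that N by (auto simp: i_def j_def)
  have off_S: "e \<in> N \<union> {x, y} \<longleftrightarrow> e \<in> N" "e \<in> N\<^sub>1 \<union> {x\<^sub>1, y\<^sub>1} \<longleftrightarrow> e \<in> N\<^sub>1"
    if "e \<in> edges G - S" for e
    using that xy by auto
  have "height_function G (N\<^sub>1 \<union> {x\<^sub>1, y\<^sub>1}) (N \<union> {x, y}) h \<longleftrightarrow>
     ?support h \<and> ?rest h \<and> (\<forall>e\<in>S. i e - j e = h (left_face G e) - h (right_face G e))"
    unfolding height_function_def split by (simp only: on_S off_S cong: ball_cong)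
  moreover have "(\<forall>e\<in>S. i e - j e = h (left_face G e) - h (right_face G e)) \<longleftrightarrow>
     h f\<^sub>1 - h f\<^sub>4 = of_bool (b\<^sub>1 \<in> pair_type (x, y)) - of_bool (b\<^sub>1 \<in> pair_type (x\<^sub>1, y\<^sub>1)) \<and>
     h f\<^sub>2 - h f\<^sub>1 = of_bool (b\<^sub>2 \<in> pair_type (x, y)) - of_bool (b\<^sub>2 \<in> pair_type (x\<^sub>1, y\<^sub>1)) \<and>
     h f\<^sub>3 - h f\<^sub>2 = of_bool (b\<^sub>3 \<in> pair_type (x, y)) - of_bool (b\<^sub>3 \<in> pair_type (x\<^sub>1, y\<^sub>1)) \<and>
     h f\<^sub>4 - h f\<^sub>3 = of_bool (b\<^sub>4 \<in> pair_type (x, y)) - of_bool (b\<^sub>4 \<in> pair_type (x\<^sub>1, y\<^sub>1)) \<and>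
     h f = inner_height (x\<^sub>1, y\<^sub>1) (x, y) h"
    unfolding I(4-7,11-14) ball_simps left_face_site right_face_site inner_height_def fst_conv
      I(3,10)[symmetric]
    using I(1,2,8,9) by (intro iffI; elim conjE; intro conjI TrueI; linarith)
  moreover have "?support h \<longleftrightarrow> ?support (h(f := 0))"
  proof -
    have "(h(f := 0)) F = h F" if "F \<notin> faces G - {outer G}" for F
      by (rule fun_upd_other) (use that f_face in blast)
    then show ?thesis
      by metis
  qed
  moreover have "?rest h \<longleftrightarrow> ?rest (h(f := 0))"
  proof (rule ball_cong[OF refl])
    fix e assume e: "e \<in> edges G - S"
    then have "left_face G e \<noteq> f" "right_face G e \<noteq> f"
      using right_face_eq_f left_face_eq_f_iff by auto
    then show "(of_bool (e \<in> N) - of_bool (e \<in> N\<^sub>1) = h (left_face G e) - h (right_face G e)) \<longleftrightarrow>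
        (of_bool (e \<in> N) - of_bool (e \<in> N\<^sub>1) =
          (h(f := 0)) (left_face G e) - (h(f := 0)) (right_face G e))"
      by simp
  qed
  moreover have upd: "(h(f := 0)) f\<^sub>1 = h f\<^sub>1" "(h(f := 0)) f\<^sub>2 = h f\<^sub>2" "(h(f := 0)) f\<^sub>3 = h f\<^sub>3"
    "(h(f := 0)) f\<^sub>4 = h f\<^sub>4" "(h(f := 0)) f = 0"
    using site_faces_neq_f by simp_all
  ultimately show ?thesis
    unfolding exterior_height_def upd by argo
qed

lemma dimer_heights_bij:
  assumes p1: "(x\<^sub>1, y\<^sub>1) \<in> local_pairs" and N1: "N\<^sub>1 \<inter> S = {}"
  shows "bij_betw (\<lambda>(p, N, g). (N \<union> {fst p, snd p}, g(f := inner_height (x\<^sub>1, y\<^sub>1) p g)))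
    (SIGMA p:local_pairs. exterior N\<^sub>1 (pair_type (x\<^sub>1, y\<^sub>1)) (pair_type p))
    {(M, h). dimer G M \<and> height_function G (N\<^sub>1 \<union> {x\<^sub>1, y\<^sub>1}) M h}"
    (is "bij_betw ?\<Phi> ?A ?P")
proof (rule bij_betwI')
  have ext: "N \<inter> S = {}" "g f = 0" "g(f := k, f := 0) = g"
    if "(N, g) \<in> exterior N\<^sub>1 (pair_type (x\<^sub>1, y\<^sub>1)) (pair_type p)" for N g p k
    using that by (auto simp: exterior_def exterior_dimer_def exterior_height_def)
  fix u assume u: "u \<in> ?A"
  obtain x y N g where uu: "u = ((x, y), N, g)"
    by (metis surj_pair)
  have xy: "(x, y) \<in> local_pairs" and Ng: "(N, g) \<in> exterior N\<^sub>1 (pair_type (x\<^sub>1, y\<^sub>1)) (pair_type (x, y))"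
    using u uu by auto
  show "?\<Phi> u \<in> ?P"
    using dimer_iff_exterior[OF xy ext(1)[OF Ng]]
      height_function_iff_exterior[OF xy p1 ext(1)[OF Ng] N1] Ng ext(3)[OF Ng] site_faces_neq_f
    unfolding uu by (auto simp: exterior_def inner_height_def)
  fix v assume v: "v \<in> ?A"
  obtain x' y' N' g' where vv: "v = ((x', y'), N', g')"
    by (metis surj_pair)
  have xy': "(x', y') \<in> local_pairs" and Ng': "(N', g') \<in> exterior N\<^sub>1 (pair_type (x\<^sub>1, y\<^sub>1)) (pair_type (x', y'))"
    using v vv by auto
  show "(?\<Phi> u = ?\<Phi> v) = (u = v)"
  proof
    assume eq: "?\<Phi> u = ?\<Phi> v"
    have "N = (N \<union> {x, y}) - S" "N' = (N' \<union> {x', y'}) - S"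
      using local_pairsD(7,8)[OF xy] local_pairsD(7,8)[OF xy'] ext(1)[OF Ng] ext(1)[OF Ng'] by auto
    then have "N = N'"
      using eq unfolding uu vv by simp
    moreover have "{x, y} = (N \<union> {x, y}) \<inter> S" "{x', y'} = (N' \<union> {x', y'}) \<inter> S"
      using local_pairsD(7,8)[OF xy] local_pairsD(7,8)[OF xy'] ext(1)[OF Ng] ext(1)[OF Ng'] by auto
    then have "{x, y} = {x', y'}"
      using eq unfolding uu vv by simp
    then have "x = x' \<and> y = y'"
      using local_pairsD(4,5)[OF xy] local_pairsD(4,5)[OF xy'] site_whites(5) by (metis doubleton_eq_iff)
    moreover have "g = g'"
      using eq ext(3)[OF Ng] ext(3)[OF Ng'] unfolding uu vv by (metis (no_types, lifting) case_prod_conv prod.inject)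
    ultimately show "u = v"
      by (simp add: uu vv)
  qed simp
next
  fix Mh assume Mh: "Mh \<in> ?P"
  obtain M h where mm: "Mh = (M, h)" "dimer G M" "height_function G (N\<^sub>1 \<union> {x\<^sub>1, y\<^sub>1}) M h"
    using Mh by auto
  obtain x y where xy: "(x, y) \<in> local_pairs" "M \<inter> S = {x, y}"
    using dimer_local_pair[OF mm(2)] .
  have M: "M = (M - S) \<union> {x, y}" "(M - S) \<inter> S = {}"
    using xy by auto
  have h: "h = h(f := 0, f := h f)" "inner_height (x\<^sub>1, y\<^sub>1) (x, y) h = inner_height (x\<^sub>1, y\<^sub>1) (x, y) (h(f := 0))"
    using site_faces_neq_f by (auto simp: inner_height_def)
  have "(M - S, h(f := 0)) \<in> exterior N\<^sub>1 (pair_type (x\<^sub>1, y\<^sub>1)) (pair_type (x, y))"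
    and hf: "h f = inner_height (x\<^sub>1, y\<^sub>1) (x, y) h"
    using mm(2,3) M dimer_iff_exterior[OF xy(1) M(2)]
      height_function_iff_exterior[OF xy(1) p1 M(2) N1, of h]
    by (auto simp: exterior_def)
  moreover have "Mh = ?\<Phi> ((x, y), M - S, h(f := 0))"
    using M(1) h hf mm(1) by simp
  ultimately show "\<exists>u\<in>?A. Mh = ?\<Phi> u"
    using xy(1) by blast
qed

end

section \<open>Expansion along the two white vertices of the site\<close>

abbreviation dimer_heights :: "bgraph \<Rightarrow> nat set \<Rightarrow> (nat set \<times> (nat set \<Rightarrow> int)) set" where
  "dimer_heights G M\<^sub>1 \<equiv> {(M, h). dimer G M \<and> height_function G M\<^sub>1 M h}"

definition dimer_weight :: "bgraph \<Rightarrow> (nat \<Rightarrow> complex) \<Rightarrow> nat set \<times> (nat set \<Rightarrow> int) \<Rightarrow> complex" where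
  "dimer_weight G K = (\<lambda>(M, h). \<Prod>F\<in>faces G. face_weight G K F powi h F)"

context spider_region
begin

text \<open>
  The sign with which a local pair enters its minor. It arises because using \<open>e13\<close> raises the height of \<open>f\<close> by
  one, and \<open>f\<close> has face sign \<open>- 1\<close>.
\<close>

definition pair_sign :: "nat \<times> nat \<Rightarrow> complex" where
  "pair_sign p = (if fst p = e13 then - 1 else 1)"

text \<open>
  The factor \<open>V\<^sub>T\<close>: the signed weight of all exteriors of type \<open>T\<close>, in the role of a complementary minor in the
  expansion of a determinant along the rows of \<open>w\<^sub>1\<close> and \<open>w\<^sub>2\<close>.
\<close>

definition exterior_sum :: "(nat \<Rightarrow> complex) \<Rightarrow> nat set \<Rightarrow> nat set \<Rightarrow> nat set \<Rightarrow> complex" where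
  "exterior_sum K N\<^sub>1 T\<^sub>1 T = (\<Sum>(N, g)\<in>exterior N\<^sub>1 T\<^sub>1 T.
     face_sign (faces G - {f}) g * (- 1) powi g f\<^sub>2 * (\<Prod>e\<in>N. K e))"

definition dimer_heights_at :: "nat set \<Rightarrow> nat \<times> nat \<Rightarrow> (nat set \<times> (nat set \<Rightarrow> int)) set" where
  "dimer_heights_at M\<^sub>1 p = {(M, h) \<in> dimer_heights G M\<^sub>1. {fst p, snd p} \<subseteq> M}"

lemma finite_local_pairs: "finite local_pairs"
  by (simp add: local_pairs_def)

lemma local_pairs_eqI:
  assumes "(x, y) \<in> local_pairs" and "(x', y') \<in> local_pairs" and "{x, y} \<subseteq> N \<union> {x', y'}" and "N \<inter> S = {}"
  shows "x = x' \<and> y = y'"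
proof -
  have "x \<in> {x', y'}" "y \<in> {x', y'}"
    using assms(3,4) local_pairsD(7,8)[OF assms(1)] by auto
  then show ?thesis
    using local_pairsD(4,5)[OF assms(1)] local_pairsD(4,5)[OF assms(2)] site_whites(5) by fastforce
qed

lemma dimer_heights_at_bij:
  assumes p1: "(x\<^sub>1, y\<^sub>1) \<in> local_pairs" and N1: "N\<^sub>1 \<inter> S = {}" and p: "p \<in> local_pairs"
  shows "bij_betw (\<lambda>(N, g). (N \<union> {fst p, snd p}, g(f := inner_height (x\<^sub>1, y\<^sub>1) p g)))
    (exterior N\<^sub>1 (pair_type (x\<^sub>1, y\<^sub>1)) (pair_type p)) (dimer_heights_at (N\<^sub>1 \<union> {x\<^sub>1, y\<^sub>1}) p)"
    (is "bij_betw ?\<phi> ?E ?D")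
proof -
  let ?\<Phi> = "\<lambda>(p, N, g). (N \<union> {fst p, snd p}, g(f := inner_height (x\<^sub>1, y\<^sub>1) p g))"
  let ?A = "SIGMA p:local_pairs. exterior N\<^sub>1 (pair_type (x\<^sub>1, y\<^sub>1)) (pair_type p)"
  note bij = dimer_heights_bij[OF p1 N1]
  have "bij_betw ?\<Phi> (Pair p ` ?E) (?\<Phi> ` (Pair p ` ?E))"
    by (rule bij_betw_subset[OF bij]) (use p in auto)
  moreover have "bij_betw (Pair p) ?E (Pair p ` ?E)"
    by (simp add: bij_betw_def inj_on_def)
  ultimately have "bij_betw (?\<Phi> \<circ> Pair p) ?E (?\<Phi> ` (Pair p ` ?E))"
    by (rule bij_betw_trans[rotated])
  moreover have "?\<Phi> \<circ> Pair p = ?\<phi>"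
    by auto
  moreover have "?\<Phi> ` (Pair p ` ?E) = ?D"
  proof (intro equalityI subsetI)
    fix v assume "v \<in> ?\<Phi> ` (Pair p ` ?E)"
    then obtain N g where v: "v = ?\<Phi> (p, N, g)" "(p, N, g) \<in> ?A"
      using p by auto
    have "v \<in> dimer_heights G (N\<^sub>1 \<union> {x\<^sub>1, y\<^sub>1})"
      unfolding v(1) by (rule bspec[OF bij_betwE[OF bij] v(2)])
    then show "v \<in> ?D"
      using v(1) by (auto simp: dimer_heights_at_def)
  next
    fix v assume v: "v \<in> ?D"
    then have "v \<in> ?\<Phi> ` ?A"
      unfolding bij_betw_imp_surj_on[OF bij] by (auto simp: dimer_heights_at_def)
    then obtain u where u: "v = ?\<Phi> u" "u \<in> ?A"
      by (rule imageE)
    obtain q N g where "u = (q, N, g)"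
      by (cases u)
    with u have q: "(q, N, g) \<in> ?A" "v = ?\<Phi> (q, N, g)"
      by simp_all
    have "{fst p, snd p} \<subseteq> N \<union> {fst q, snd q}" "N \<inter> S = {}"
      using v q by (auto simp: dimer_heights_at_def exterior_def exterior_dimer_def)
    then have "p = q"
      using local_pairs_eqI[of "fst p" "snd p" "fst q" "snd q" N] p q(1) by (auto simp: prod_eq_iff)
    then show "v \<in> ?\<Phi> ` (Pair p ` ?E)"
      using q by blast
  qed
  ultimately show ?thesis
    by simp
qed

lemma finite_dimer_heights_iff_exterior:
  assumes p1: "(x\<^sub>1, y\<^sub>1) \<in> local_pairs" and N1: "N\<^sub>1 \<inter> S = {}"
  shows "finite (dimer_heights G (N\<^sub>1 \<union> {x\<^sub>1, y\<^sub>1})) \<longleftrightarrow>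
    (\<forall>p\<in>local_pairs. finite (exterior N\<^sub>1 (pair_type (x\<^sub>1, y\<^sub>1)) (pair_type p)))"
proof
  assume "finite (dimer_heights G (N\<^sub>1 \<union> {x\<^sub>1, y\<^sub>1}))"
  then have "finite (dimer_heights_at (N\<^sub>1 \<union> {x\<^sub>1, y\<^sub>1}) p)" for p
    by (rule rev_finite_subset) (auto simp: dimer_heights_at_def)
  then show "\<forall>p\<in>local_pairs. finite (exterior N\<^sub>1 (pair_type (x\<^sub>1, y\<^sub>1)) (pair_type p))"
    by (intro ballI) (simp only: bij_betw_finite[OF dimer_heights_at_bij[OF p1 N1]])
next
  assume "\<forall>p\<in>local_pairs. finite (exterior N\<^sub>1 (pair_type (x\<^sub>1, y\<^sub>1)) (pair_type p))"
  then show "finite (dimer_heights G (N\<^sub>1 \<union> {x\<^sub>1, y\<^sub>1}))"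
    unfolding bij_betw_finite[OF dimer_heights_bij[OF p1 N1], symmetric]
    by (intro finite_SigmaI finite_local_pairs) blast
qed

lemma face_sign_update:
  "face_sign (faces G) (g(f := k)) = (- 1) powi k * face_sign (faces G - {f}) g"
proof -
  have "face_sign (faces G) (g(f := k)) =
      ((- 1) ^ (card f + 1)) powi k * face_sign (faces G - {f}) (g(f := k))"
    unfolding face_sign_def by (subst prod.remove[OF finite_faces f_face(1)]) simp
  also have "face_sign (faces G - {f}) (g(f := k)) = face_sign (faces G - {f}) g"
    unfolding face_sign_def by (rule prod.cong) auto
  also have "card f = 2"
    using site_distinct by simp
  finally show ?thesis
    by (simp del: fun_upd_apply)
qed

lemma inner_height_sign:
  "(- 1 :: complex) powi inner_height p\<^sub>1 p g = (- 1) powi g f\<^sub>2 * pair_sign p * pair_sign p\<^sub>1"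
  by (simp add: inner_height_def pair_sign_def power_int_add power_int_diff)

text \<open>
  The contribution of one local pair. The factor on the left is the weight of the reference with its local sign;
  it is the same for all local pairs.
\<close>

lemma dimer_heights_at_sum:
  assumes nz: "\<And>e. e \<in> edges G \<Longrightarrow> K e \<noteq> 0"
    and p1: "(x\<^sub>1, y\<^sub>1) \<in> local_pairs" and N1: "N\<^sub>1 \<subseteq> edges G - S" and p: "p \<in> local_pairs"
  shows "(\<Sum>v\<in>dimer_heights_at (N\<^sub>1 \<union> {x\<^sub>1, y\<^sub>1}) p. dimer_weight G K v) *
      (pair_sign (x\<^sub>1, y\<^sub>1) * K x\<^sub>1 * K y\<^sub>1 * (\<Prod>e\<in>N\<^sub>1. K e)) =
    pair_sign p * K (fst p) * K (snd p) * exterior_sum K N\<^sub>1 (pair_type (x\<^sub>1, y\<^sub>1)) (pair_type p)"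
proof -
  have N1': "N\<^sub>1 \<inter> S = {}"
    using N1 by auto
  let ?E = "exterior N\<^sub>1 (pair_type (x\<^sub>1, y\<^sub>1)) (pair_type p)"
  let ?\<phi> = "\<lambda>(N, g). (N \<union> {fst p, snd p}, g(f := inner_height (x\<^sub>1, y\<^sub>1) p g))"
  let ?D = "pair_sign (x\<^sub>1, y\<^sub>1) * K x\<^sub>1 * K y\<^sub>1 * (\<Prod>e\<in>N\<^sub>1. K e)"
  have p': "(fst p, snd p) \<in> local_pairs"
    using p by simp
  note D = local_pairsD(7,8,6)[OF p'] and D\<^sub>1 = local_pairsD(7,8,6)[OF p1]
  have ends: "fst p \<in> edges G" "snd p \<in> edges G" "x\<^sub>1 \<in> edges G" "y\<^sub>1 \<in> edges G"
    using subsetD[OF site_edges] D(1,2) D\<^sub>1(1,2) by blast+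
  have rot: "rotB G e \<in> edges G" if "e \<in> edges G" for e
    using that permutes_in_image[OF rotB_permutes] by simp
  have glue: "(\<Prod>e\<in>N \<union> {x, y}. K e) = (\<Prod>e\<in>N. K e) * (K x * K y)"
    if "N \<subseteq> edges G - S" "x \<in> S" "y \<in> S" "x \<noteq> y" for N x y
  proof -
    have "finite N" "N \<inter> {x, y} = {}"
      using that finite_edges by (auto intro: finite_subset)
    then show ?thesis
      using that(4) by (subst prod.union_disjoint) auto
  qed
  have P1: "(\<Prod>e\<in>N\<^sub>1 \<union> {x\<^sub>1, y\<^sub>1}. K e) = (\<Prod>e\<in>N\<^sub>1. K e) * (K x\<^sub>1 * K y\<^sub>1)"
    by (rule glue[OF N1 D\<^sub>1])
  have P1_nz: "(\<Prod>e\<in>N\<^sub>1. K e) \<noteq> 0" "K x\<^sub>1 \<noteq> 0" "K y\<^sub>1 \<noteq> 0"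
  proof -
    have "N\<^sub>1 \<subseteq> edges G"
      using N1 by blast
    then show "(\<Prod>e\<in>N\<^sub>1. K e) \<noteq> 0"
      using nz finite_subset[OF _ finite_edges, of N\<^sub>1] by auto
  qed (use nz ends in auto)
  have sq: "pair_sign (x\<^sub>1, y\<^sub>1) = 1 \<or> pair_sign (x\<^sub>1, y\<^sub>1) = - 1"
    by (simp add: pair_sign_def)
  \<comment> \<open>The sign of the reference, being \<open>1\<close> or \<open>- 1\<close>, squares to \<open>1\<close>.\<close>
  have normalise: "W * (s' * k' * l' * m') = s * k * l * (F * a * m)"
    if "W = a * s * s' * F * ((m * (k * l)) / (m' * (k' * l')))" "s' = 1 \<or> s' = - 1"
      "m' \<noteq> 0" "k' \<noteq> 0" "l' \<noteq> 0" for W a s s' F k l m k' l' m' :: complex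
    using that(2) by (rule disjE) (simp_all add: that(1,3-5))
  have "dimer_weight G K (?\<phi> (N, g)) * ?D = pair_sign p * K (fst p) * K (snd p) *
      (face_sign (faces G - {f}) g * (- 1) powi g f\<^sub>2 * (\<Prod>e\<in>N. K e))"
    if Ng: "(N, g) \<in> ?E" for N g
  proof -
    have N: "N \<subseteq> edges G - S"
      using Ng by (auto simp: exterior_def exterior_dimer_def)
    have "?\<phi> (N, g) \<in> dimer_heights_at (N\<^sub>1 \<union> {x\<^sub>1, y\<^sub>1}) p"
      by (rule bspec[OF bij_betwE[OF dimer_heights_at_bij[OF p1 N1' p]] Ng])
    then have "height_function G (N\<^sub>1 \<union> {x\<^sub>1, y\<^sub>1}) (N \<union> {fst p, snd p})
        (g(f := inner_height (x\<^sub>1, y\<^sub>1) p g))"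
      by (auto simp: dimer_heights_at_def)
    then have "dimer_weight G K (?\<phi> (N, g)) =
        face_sign (faces G) (g(f := inner_height (x\<^sub>1, y\<^sub>1) p g)) *
        ((\<Prod>e\<in>N \<union> {fst p, snd p}. K e) / (\<Prod>e\<in>N\<^sub>1 \<union> {x\<^sub>1, y\<^sub>1}. K e))"
      unfolding dimer_weight_def prod.case
      by (intro face_weights_edge_weights finite_edges rot nz)
        (use N N1 ends in blast)+
    also have "\<dots> = (- 1) powi g f\<^sub>2 * pair_sign p * pair_sign (x\<^sub>1, y\<^sub>1) * face_sign (faces G - {f}) g *
        (((\<Prod>e\<in>N. K e) * (K (fst p) * K (snd p))) / ((\<Prod>e\<in>N\<^sub>1. K e) * (K x\<^sub>1 * K y\<^sub>1)))"
      using glue[OF N D] by (simp only: face_sign_update inner_height_sign P1)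
    finally show ?thesis
      by (rule normalise) (use P1_nz sq in auto)
  qed
  then have "(\<Sum>v\<in>?E. dimer_weight G K (?\<phi> v) * ?D) = (\<Sum>v\<in>?E. pair_sign p * K (fst p) * K (snd p) *
      (case v of (N, g) \<Rightarrow> face_sign (faces G - {f}) g * (- 1) powi g f\<^sub>2 * (\<Prod>e\<in>N. K e)))"
    by (intro sum.cong) auto
  then have "(\<Sum>v\<in>?E. dimer_weight G K (?\<phi> v)) * ?D =
      pair_sign p * K (fst p) * K (snd p) * exterior_sum K N\<^sub>1 (pair_type (x\<^sub>1, y\<^sub>1)) (pair_type p)"
    unfolding exterior_sum_def sum_distrib_left sum_distrib_right .
  then show ?thesis
    unfolding sum.reindex_bij_betw[OF dimer_heights_at_bij[OF p1 N1' p], symmetric] .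
qed

lemma face_partition_function_split:
  assumes "finite (dimer_heights G M\<^sub>1)"
  shows "face_partition_function G K M\<^sub>1 =
    (\<Sum>p\<in>local_pairs. \<Sum>v\<in>dimer_heights_at M\<^sub>1 p. dimer_weight G K v)"
proof -
  have union: "dimer_heights G M\<^sub>1 = (\<Union>p\<in>local_pairs. dimer_heights_at M\<^sub>1 p)"
  proof (intro equalityI subsetI)
    fix v assume v: "v \<in> dimer_heights G M\<^sub>1"
    then obtain M h where vM: "v = (M, h)" "dimer G M"
      by auto
    then obtain x y where "(x, y) \<in> local_pairs" "M \<inter> S = {x, y}"
      using dimer_local_pair by blast
    then show "v \<in> (\<Union>p\<in>local_pairs. dimer_heights_at M\<^sub>1 p)"
      using v vM by (force simp: dimer_heights_at_def)
  qed (auto simp: dimer_heights_at_def)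
  have disj: "dimer_heights_at M\<^sub>1 p \<inter> dimer_heights_at M\<^sub>1 q = {}"
    if pq: "p \<in> local_pairs" "q \<in> local_pairs" "p \<noteq> q" for p q
  proof (rule ccontr)
    assume "dimer_heights_at M\<^sub>1 p \<inter> dimer_heights_at M\<^sub>1 q \<noteq> {}"
    then obtain M where M: "dimer G M" "{fst p, snd p} \<subseteq> M" "{fst q, snd q} \<subseteq> M"
      by (auto simp: dimer_heights_at_def)
    obtain x y where xy: "(x, y) \<in> local_pairs" "M \<inter> S = {x, y}"
      using dimer_local_pair[OF M(1)] .
    have pq': "(fst p, snd p) \<in> local_pairs" "(fst q, snd q) \<in> local_pairs"
      using pq by auto
    have M': "M \<subseteq> (M - S) \<union> {x, y}" "(M - S) \<inter> S = {}"
      using xy(2) by auto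
    show False
      using local_pairs_eqI[OF pq'(1) xy(1) subset_trans[OF M(2) M'(1)] M'(2)]
        local_pairs_eqI[OF pq'(2) xy(1) subset_trans[OF M(3) M'(1)] M'(2)] pq(3)
      by (simp add: prod_eq_iff)
  qed
  have "face_partition_function G K M\<^sub>1 = (\<Sum>v\<in>dimer_heights G M\<^sub>1. dimer_weight G K v)"
    by (simp add: face_partition_function_def dimer_weight_def case_prod_beta')
  also have "\<dots> = (\<Sum>p\<in>local_pairs. \<Sum>v\<in>dimer_heights_at M\<^sub>1 p. dimer_weight G K v)"
    unfolding union
  proof (rule sum.UNION_disjoint[OF finite_local_pairs])
    show "\<forall>p\<in>local_pairs. finite (dimer_heights_at M\<^sub>1 p)"
      using assms by (auto simp: dimer_heights_at_def intro: rev_finite_subset)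
  qed (use disj in blast)
  finally show ?thesis .
qed

end

section \<open>The graph after the move\<close>

text \<open>
  The edges at a vertex form an orbit of the rotation, and the site prescribes the rotation at \<open>w\<^sub>1\<close> and \<open>w\<^sub>2\<close>
  completely.
\<close>

lemma planar_spider_region:
  assumes G: "planar_bipartite G" and site: "spider_site G e11 e12 e13 e21 e23 e24"
  shows "spider_region G e11 e12 e13 e21 e23 e24"
proof -
  have fin: "finite (edges G)" and W: "rotW G permutes edges G" and B: "rotB G permutes edges G"
    and white': "\<forall>e\<in>edges G. \<forall>e'\<in>edges G. white_of G e = white_of G e' \<longleftrightarrow> e' \<in> orbit (rotW G) e"
    and black': "\<forall>e\<in>edges G. \<forall>e'\<in>edges G. black_of G e = black_of G e' \<longleftrightarrow> e' \<in> orbit (rotB G) e"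
    using G unfolding planar_bipartite_def by - (elim conjE, assumption)+
  note white = white'[THEN bspec, THEN bspec] and black = black'[THEN bspec, THEN bspec]
  have rot: "rotW G e11 = e12" "rotW G e12 = e13" "rotW G e13 = e11"
    "rotW G e21 = e23" "rotW G e23 = e24" "rotW G e24 = e21" "rotB G e11 = e21" "rotB G e23 = e13"
    and E: "e11 \<in> edges G" "e12 \<in> edges G" "e13 \<in> edges G" "e21 \<in> edges G" "e23 \<in> edges G" "e24 \<in> edges G"
    using site unfolding spider_site_def by simp_all
  have three_cycle: "{e' \<in> edges G. white_of G e' = white_of G x} = {x, y, z}"
    if "rotW G x = y" "rotW G y = z" "rotW G z = x" "x \<in> edges G" "y \<in> edges G" "z \<in> edges G" for x y z
  proof -
    have "orbit (rotW G) x = {x, y, z}"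
      using orbit_three_cycle[of "rotW G" x] that(1-3) by simp
    then show ?thesis
      using white[OF that(4)] that(4-6) by (auto simp: eq_commute)
  qed
  show ?thesis
  proof
    show "{e \<in> edges G. white_of G e = white_of G e11} = {e11, e12, e13}"
      by (rule three_cycle) (use rot E in auto)
    show "{e \<in> edges G. white_of G e = white_of G e21} = {e21, e23, e24}"
      by (rule three_cycle) (use rot E in auto)
    show "black_of G e21 = black_of G e11"
      using black[OF E(1,4)] orbit.base[of "rotB G" e11] rot by simp
    show "black_of G e23 = black_of G e13"
      using black[OF E(5,3)] orbit.base[of "rotB G" e23] rot by simp
  qed (fact fin W B site)+
qed

locale spider_move_region = spider_region +
  assumes planar: "planar_bipartite G"
begin

abbreviation "G' \<equiv> spider_move G e11 e12 e13 e21 e23 e24"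

lemma move_simps:
  "edges G' = edges G" "outer G' = outer G"
  "white_of G' = (white_of G)(e11 := w\<^sub>1, e13 := w\<^sub>1, e24 := w\<^sub>1, e12 := w\<^sub>2, e23 := w\<^sub>2, e21 := w\<^sub>2)"
  "black_of G' = (black_of G)(e13 := b\<^sub>2, e21 := b\<^sub>4)"
  "rotW G' = (rotW G)(e11 := e13, e13 := e24, e24 := e11, e12 := e23, e23 := e21, e21 := e12)"
  "rotB G' = (rotB G)(e11 := rotB G e21, e12 := e13, e13 := rotB G e12, e23 := rotB G e13,
     e24 := e21, e21 := rotB G e24)"
  by (cases G; simp only: spider_move_def bgraph.simps)+

lemma left_face_move: "left_face G' = left_face G"
  unfolding left_face_def spider_move_face_rotation[OF planar site] ..

lemma faces_move: "faces G' = faces G"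
  unfolding faces_def left_face_move move_simps ..

lemma move_off_S:
  assumes "e \<notin> S"
  shows "white_of G' e = white_of G e" "black_of G' e = black_of G e" "rotW G' e = rotW G e"
    "rotB G' e = rotB G e" "right_face G' e = right_face G e"
  using assms by (simp_all add: move_simps right_face_def left_face_move)

lemma white_of_move:
  "white_of G' e11 = w\<^sub>1" "white_of G' e13 = w\<^sub>1" "white_of G' e24 = w\<^sub>1"
  "white_of G' e12 = w\<^sub>2" "white_of G' e23 = w\<^sub>2" "white_of G' e21 = w\<^sub>2"
  by (simp_all only: move_simps fun_upd_apply site_distinct simp_thms if_True if_False)

lemma black_of_move:
  "black_of G' e11 = b\<^sub>1" "black_of G' e13 = b\<^sub>2" "black_of G' e24 = b\<^sub>4"
  "black_of G' e12 = b\<^sub>2" "black_of G' e23 = b\<^sub>3" "black_of G' e21 = b\<^sub>4"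
  by (simp_all only: move_simps fun_upd_apply site_distinct simp_thms if_True if_False black_shared)

lemma rot_move:
  "rotW G' e11 = e13" "rotW G' e13 = e24" "rotW G' e24 = e11"
  "rotW G' e12 = e23" "rotW G' e23 = e21" "rotW G' e21 = e12" "rotB G' e12 = e13" "rotB G' e24 = e21"
  by (simp_all only: move_simps fun_upd_apply site_distinct simp_thms if_True if_False)

lemma rotW_move_permutes: "rotW G' permutes edges G"
proof (rule bij_imp_permutes)
  have closed: "rotW G x \<in> S" if "x \<in> S" for x
    using that site_rot by auto
  have "edges G \<subseteq> rotW G' ` edges G"
  proof
    fix y assume y: "y \<in> edges G"
    show "y \<in> rotW G' ` edges G"
    proof (cases "y \<in> S")
      case True
      then have "y \<in> rotW G' ` S"
        unfolding image_insert image_empty rot_move by blast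
      then show ?thesis
        using site_edges by blast
    next
      case False
      obtain x where x: "x \<in> edges G" "y = rotW G x"
        using y permutes_image[OF rotW_permutes] by blast
      then show ?thesis
        using closed False move_off_S(3)[of x] by (metis imageI)
    qed
  qed
  moreover have "rotW G' x \<in> edges G" if "x \<in> edges G" for x
  proof (cases "x \<in> S")
    case True
    then have "rotW G' x \<in> S"
      using rot_move by auto
    then show ?thesis
      using site_edges by blast
  next
    case False
    then show ?thesis
      using that permutes_in_image[OF rotW_permutes] move_off_S(3) by simp
  qed
  ultimately show "bij_betw (rotW G') (edges G) (edges G)"
    unfolding bij_betw_def using finite_surj_inj[OF finite_edges] by blast
  show "rotW G' x = x" if "x \<notin> edges G" for x
    using that site_edges move_off_S(3)[of x] permutes_not_in[OF rotW_permutes] by auto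
qed

text \<open>
  The move preserves the composition of the two rotations, so \<open>rotB\<close> is determined by \<open>rotW\<close>.
\<close>

lemma rotB_move_permutes: "rotB G' permutes edges G"
proof -
  have "(rotB G' \<circ> rotW G') \<circ> inv (rotW G') permutes edges G"
    unfolding spider_move_face_rotation[OF planar site]
    by (intro permutes_compose permutes_inv rotW_move_permutes rotW_permutes rotB_permutes)
  then show ?thesis
    by (simp only: o_assoc[symmetric] permutes_inv_o(1)[OF rotW_move_permutes] o_id)
qed

text \<open>
  After the move the two white vertices share \<open>b\<^sub>2\<close> and \<open>b\<^sub>4\<close>. Turning the picture by a quarter, so that
  \<open>b\<^sub>4, b\<^sub>1, b\<^sub>2, b\<^sub>3\<close> take the places of \<open>b\<^sub>1, b\<^sub>2, b\<^sub>3, b\<^sub>4\<close>, shows a site of the original shape with the same inner face.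
\<close>

lemma moved_region: "spider_region G' e24 e11 e13 e21 e12 e23"
proof
  have off: "white_of G' e \<noteq> w\<^sub>1 \<and> white_of G' e \<noteq> w\<^sub>2" if "e \<in> edges G - S" for e
    using that move_off_S(1)[of e] site_edge_iff[of e] by auto
  have on: "{e \<in> edges G'. white_of G' e = w} = {e \<in> S. white_of G' e = w}" if "w = w\<^sub>1 \<or> w = w\<^sub>2" for w
    using that off site_edges unfolding move_simps(1) by blast
  have three: "{e \<in> insert a (insert b (insert c (insert x (insert y (insert z {}))))). P e} = {x', y', z'}"
    if "{a, b, c, x, y, z} = {x', y', z', a', b', c'}" "P x'" "P y'" "P z'" "\<not> P a'" "\<not> P b'" "\<not> P c'"
    for a b c x y z x' y' z' a' b' c' :: nat and P
    unfolding that(1) using that(2-) by auto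
  show "{e \<in> edges G'. white_of G' e = white_of G' e24} = {e24, e11, e13}"
    unfolding white_of_move on[OF disjI1[OF refl]]
    by (rule three[of _ _ _ _ _ _ _ _ _ e12 e23 e21]) (use site_whites in \<open>auto simp: white_of_move\<close>)
  show "{e \<in> edges G'. white_of G' e = white_of G' e21} = {e21, e12, e23}"
    unfolding white_of_move on[OF disjI2[OF refl]]
    by (rule three[of _ _ _ _ _ _ _ _ _ e11 e13 e24]) (use site_whites in \<open>auto simp: white_of_move\<close>)
  show "spider_site G' e24 e11 e13 e21 e12 e23"
    unfolding spider_site_def rot_move black_of_move move_simps(1,2)
    using site_edges site_distinct site_blacks f_face by auto
qed (simp_all add: black_of_move move_simps(1) finite_edges rotW_move_permutes rotB_move_permutes)

sublocale moved: spider_region G' e24 e11 e13 e21 e12 e23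
  by (rule moved_region)

lemma moved_S: "{e24, e11, e13, e21, e12, e23} = S"
  by auto

lemma whites_move: "whites G' = whites G" and blacks_move: "blacks G' = blacks G"
proof -
  have E: "edges G = (edges G - S) \<union> S"
    using site_edges by blast
  have off: "white_of G' ` (edges G - S) = white_of G ` (edges G - S)"
    "black_of G' ` (edges G - S) = black_of G ` (edges G - S)"
    by (intro image_cong refl move_off_S; blast)+
  show "whites G' = whites G"
    unfolding whites_def move_simps(1) by (subst (1 2) E, unfold image_Un off)
      (auto simp: white_of_move site_whites)
  show "blacks G' = blacks G"
    unfolding blacks_def move_simps(1) by (subst (1 2) E, unfold image_Un off)
      (auto simp: black_of_move black_shared)
qed

lemma exterior_dimer_move: "moved.exterior_dimer T N \<longleftrightarrow> exterior_dimer T N"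
proof (cases "N \<subseteq> edges G - S")
  case True
  then have eq: "white_of G' e = white_of G e" "black_of G' e = black_of G e" if "e \<in> N" for e
    using that by (intro move_off_S; blast)+
  have w: "e \<in> N \<and> white_of G' e = w \<longleftrightarrow> e \<in> N \<and> white_of G e = w"
    and b: "e \<in> N \<and> black_of G' e = w \<longleftrightarrow> e \<in> N \<and> black_of G e = w" for e w
    by (simp_all add: eq cong: conj_cong)
  have b': "(\<forall>e\<in>N. black_of G' e \<noteq> b) \<longleftrightarrow> (\<forall>e\<in>N. black_of G e \<noteq> b)" for b
    by (simp add: eq)
  show ?thesis
    unfolding moved.exterior_dimer_def exterior_dimer_def moved_S move_simps(1) white_of_move
      whites_move blacks_move w b b' ..
next
  case False
  then show ?thesis
    unfolding moved.exterior_dimer_def exterior_dimer_def moved_S move_simps(1) by blast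
qed

lemma exterior_height_move: "moved.exterior_height N\<^sub>1 T\<^sub>1 T N g \<longleftrightarrow> exterior_height N\<^sub>1 T\<^sub>1 T N g"
proof -
  have "(\<forall>e\<in>edges G - S. of_bool (e \<in> N) - of_bool (e \<in> N\<^sub>1) = g (left_face G e) - g (right_face G' e)) \<longleftrightarrow>
      (\<forall>e\<in>edges G - S. of_bool (e \<in> N) - of_bool (e \<in> N\<^sub>1) = g (left_face G e) - g (right_face G e))"
    by (intro ball_cong refl) (simp add: move_off_S(5))
  note rest = this
  have rotate: "(A \<and> B \<and> C \<and> d\<^sub>4 \<and> d\<^sub>1 \<and> d\<^sub>2 \<and> d\<^sub>3) = (A \<and> B \<and> C' \<and> d\<^sub>1 \<and> d\<^sub>2 \<and> d\<^sub>3 \<and> d\<^sub>4)"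
    if "C = C'" for A B C C' d\<^sub>1 d\<^sub>2 d\<^sub>3 d\<^sub>4
    using that by blast
  show ?thesis
    unfolding moved.exterior_height_def exterior_height_def moved_S move_simps(1,2) left_face_move
      black_of_move faces_move by (rule rotate[OF rest])
qed

text \<open>
  The exterior conditions refer only to edges off the site and to the black vertices in \<open>T\<close>, and the turned
  picture merely permutes the four jump equations. So the two graphs have the same exteriors.
\<close>

lemma exterior_move: "moved.exterior N\<^sub>1 T\<^sub>1 T = exterior N\<^sub>1 T\<^sub>1 T"
  unfolding moved.exterior_def exterior_def exterior_dimer_move exterior_height_move ..

text \<open>
  In the turned picture the height of \<open>f\<close> is measured from \<open>f\<^sub>1\<close> instead of \<open>f\<^sub>2\<close>, and these two faces are
  separated by \<open>b\<^sub>2\<close>. This sign accounts for the change.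
\<close>

definition b2_sign :: "nat set \<Rightarrow> complex" where
  "b2_sign T = (if b\<^sub>2 \<in> T then - 1 else 1)"

lemma exterior_sum_move:
  assumes K: "\<And>e. e \<notin> S \<Longrightarrow> K' e = K e"
  shows "moved.exterior_sum K' N\<^sub>1 T\<^sub>1 T = b2_sign T * b2_sign T\<^sub>1 * exterior_sum K N\<^sub>1 T\<^sub>1 T"
  unfolding moved.exterior_sum_def exterior_sum_def exterior_move sum_distrib_left
proof (rule sum.cong[OF refl], clarify)
  fix N g assume "(N, g) \<in> exterior N\<^sub>1 T\<^sub>1 T"
  then have N: "N \<subseteq> edges G - S" and g: "g f\<^sub>1 = g f\<^sub>2 - of_bool (b\<^sub>2 \<in> T) + of_bool (b\<^sub>2 \<in> T\<^sub>1)"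
    by (auto simp: exterior_def exterior_dimer_def exterior_height_def)
  have "(\<Prod>e\<in>N. K' e) = (\<Prod>e\<in>N. K e)"
    using N K by (intro prod.cong) auto
  moreover have "(- 1 :: complex) powi g f\<^sub>1 = b2_sign T * b2_sign T\<^sub>1 * (- 1) powi g f\<^sub>2"
    unfolding g by (simp add: b2_sign_def power_int_add power_int_diff)
  ultimately show "face_sign (faces G' - {f}) g * (- 1) powi g (left_face G' e11) * (\<Prod>e\<in>N. K' e) =
      b2_sign T * b2_sign T\<^sub>1 * (face_sign (faces G - {f}) g * (- 1) powi g f\<^sub>2 * (\<Prod>e\<in>N. K e))"
    by (simp add: faces_move left_face_move)
qed

end

lemma planar_spider_move_region:
  assumes "planar_bipartite G" and "spider_site G e11 e12 e13 e21 e23 e24"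
  shows "spider_move_region G e11 e12 e13 e21 e23 e24"
  using planar_spider_region[OF assms] assms(1)
  by (simp add: spider_move_region_def spider_move_region_axioms_def)

section \<open>The defect of the partition function\<close>

text \<open>
  The coefficients of the first two equations are the minors \<open>m\<^sub>T\<close> and \<open>m'\<^sub>T\<close> for
  \<open>u = H(a,b)\<close>, \<open>v = H(c,d)\<close>, \<open>x = H(a,c)\<close>, \<open>y = H(d,b)\<close>, \<open>z = H(a,d)\<close>, \<open>w = H(b,c)\<close>. Multiplied by
  \<open>- v / u\<close>, the coefficients of the first equation become those of the second in the four neighbouring types, and
  the normalisations \<open>D\<close> and \<open>D'\<close> have the same ratio. The sums \<open>A\<close> and \<open>B\<close> are parts of \<open>Z\<close> in which \<open>V\<^sub>1\<^sub>3\<close> and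
  \<open>V\<^sub>2\<^sub>4\<close> occur with a single product as coefficient; they serve to express the result by dimer weights.
\<close>

lemma three_term_defect:
  fixes u v x y z w :: complex
  assumes Z: "Z * D = - (u * w) * V\<^sub>1\<^sub>2 + u * y * V\<^sub>1\<^sub>4 + u * x * V\<^sub>2\<^sub>3 - u * z * V\<^sub>3\<^sub>4
      - (x * y + z * w) * V\<^sub>1\<^sub>3 - u * u * V\<^sub>2\<^sub>4"
    and Z': "Z' * D' = v * w * V\<^sub>1\<^sub>2 - v * y * V\<^sub>1\<^sub>4 - v * x * V\<^sub>2\<^sub>3 + v * z * V\<^sub>3\<^sub>4
      - v * v * V\<^sub>1\<^sub>3 - (x * y + z * w) * V\<^sub>2\<^sub>4"
    and D: "u * D' = - (v * D)"
    and A: "A * D = - (x * y) * V\<^sub>1\<^sub>3" and B: "B * D = - (u * u) * V\<^sub>2\<^sub>4"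
    and nz: "D \<noteq> 0" "u \<noteq> 0" "v \<noteq> 0" "x \<noteq> 0" "y \<noteq> 0"
  shows "Z - Z' = (u * v + x * y + z * w) * (A / (x * y) + B / (u * v))"
proof -
  define P Q where "P = A / (x * y)" and "Q = B / (u * v)"
  have P: "P * D = - V\<^sub>1\<^sub>3"
    using A nz by (simp add: P_def field_simps)
  have Q: "Q * (v * D) = - (u * V\<^sub>2\<^sub>4)"
    using B nz by (simp add: Q_def field_simps)
  have "(Z - Z') * (v * D) = v * (Z * D) + u * (Z' * D')"
    using D by algebra
  also have "\<dots> = (u * v + x * y + z * w) * (v * (P * D) + Q * (v * D))"
    unfolding Z Z' P Q by algebra
  also have "\<dots> = (u * v + x * y + z * w) * (P + Q) * (v * D)"
    by algebra
  finally show ?thesis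
    using nz by (simp add: P_def Q_def)
qed

context spider_move_region
begin

text \<open>
  A black vertex lies in \<open>T\<close> exactly when the exterior leaves it unmatched.
\<close>

lemma exterior_dimer_type_unique:
  assumes "exterior_dimer T N" and "exterior_dimer T' N" and "T \<subseteq> blacks G" and "T' \<subseteq> blacks G"
  shows "T = T'"
proof -
  have "T \<subseteq> T'" if "exterior_dimer T N" "exterior_dimer T' N" "T \<subseteq> blacks G" for T T'
  proof
    fix b assume b: "b \<in> T"
    show "b \<in> T'"
    proof (rule ccontr)
      assume "b \<notin> T'"
      then have "b \<in> blacks G - T'"
        using that(3) b by blast
      moreover have "\<forall>b\<in>blacks G - T'. \<exists>!e. e \<in> N \<and> black_of G e = b"
        using that(2) unfolding exterior_dimer_def by (elim conjE)
      ultimately obtain e where "e \<in> N" "black_of G e = b"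
        by (meson ex1_implies_ex)
      moreover have "\<forall>b\<in>T. \<forall>e\<in>N. black_of G e \<noteq> b"
        using that(1) unfolding exterior_dimer_def by (elim conjE)
      ultimately show False
        using b by blast
    qed
  qed
  then show ?thesis
    using assms by blast
qed

text \<open>
  The local pairs of \<open>G\<close> and \<open>G'\<close> of the four neighbouring types, for each of which both graphs have exactly one.
\<close>

definition corresponding_pairs :: "((nat \<times> nat) \<times> (nat \<times> nat)) set" where
  "corresponding_pairs = {((e12, e21), (e11, e12)), ((e11, e24), (e11, e21)),
     ((e12, e23), (e13, e23)), ((e13, e24), (e24, e23))}"

lemma pair_type_simps:
  "pair_type (e12, e21) = {b\<^sub>1, b\<^sub>2}" "pair_type (e11, e24) = {b\<^sub>1, b\<^sub>4}" "pair_type (e12, e23) = {b\<^sub>2, b\<^sub>3}"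
  "pair_type (e13, e24) = {b\<^sub>3, b\<^sub>4}" "pair_type (e11, e23) = {b\<^sub>1, b\<^sub>3}" "pair_type (e13, e21) = {b\<^sub>1, b\<^sub>3}"
  "pair_type (e12, e24) = {b\<^sub>2, b\<^sub>4}"
  "moved.pair_type (e11, e12) = {b\<^sub>1, b\<^sub>2}" "moved.pair_type (e11, e21) = {b\<^sub>1, b\<^sub>4}"
  "moved.pair_type (e13, e23) = {b\<^sub>2, b\<^sub>3}" "moved.pair_type (e24, e23) = {b\<^sub>3, b\<^sub>4}"
  "moved.pair_type (e11, e23) = {b\<^sub>1, b\<^sub>3}" "moved.pair_type (e13, e21) = {b\<^sub>2, b\<^sub>4}"
  "moved.pair_type (e24, e12) = {b\<^sub>2, b\<^sub>4}"
  by (auto simp: pair_type_def moved.pair_type_def black_of_move black_shared)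

lemma corresponding_pairsI:
  assumes "p \<in> local_pairs" and "p' \<in> moved.local_pairs" and "pair_type p = moved.pair_type p'"
    and "p \<noteq> (e11, e23)" and "p \<noteq> (e13, e21)" and "p' \<noteq> (e13, e21)" and "p' \<noteq> (e24, e12)"
  shows "(p, p') \<in> corresponding_pairs"
proof -
  have p: "p = (e12, e21) \<or> p = (e11, e24) \<or> p = (e12, e23) \<or> p = (e13, e24) \<or> p = (e12, e24)"
    using assms(1,4,5) unfolding local_pairs_def by blast
  have p': "p' = (e11, e21) \<or> p' = (e24, e23) \<or> p' = (e11, e12) \<or> p' = (e13, e23) \<or> p' = (e11, e23)"
    using assms(2,6,7) unfolding moved.local_pairs_def by blast
  have "p \<noteq> (e12, e24)"
    using p' assms(3) by (auto simp: pair_type_simps doubleton_eq_iff site_blacks)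
  then consider "p = (e12, e21)" | "p = (e11, e24)" | "p = (e12, e23)" | "p = (e13, e24)"
    using p by blast
  then show ?thesis
    by cases (use p' assms(3) in
      \<open>auto simp: corresponding_pairs_def pair_type_simps doubleton_eq_iff site_blacks\<close>)
qed

lemma corresponding_dimers_pairs:
  assumes "corresponding_dimers G G' S M M'"
  obtains N x\<^sub>1 y\<^sub>1 x\<^sub>1' y\<^sub>1' where "N \<subseteq> edges G - S" and "M = N \<union> {x\<^sub>1, y\<^sub>1}" and "M' = N \<union> {x\<^sub>1', y\<^sub>1'}"
    and "((x\<^sub>1, y\<^sub>1), (x\<^sub>1', y\<^sub>1')) \<in> corresponding_pairs"
proof -
  have M: "dimer G M" and M': "dimer G' M'" and NN: "M - S = M' - S"
    and unique: "\<And>L. dimer G L \<Longrightarrow> L - S = M - S \<Longrightarrow> L = M"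
    and unique': "\<And>L. dimer G' L \<Longrightarrow> L - S = M' - S \<Longrightarrow> L = M'"
    using assms unfolding corresponding_dimers_def by auto
  define N where "N = M - S"
  have N: "N \<inter> S = {}" "N \<inter> {e24, e11, e13, e21, e12, e23} = {}" "N - S = M - S" "N - S = M' - S"
    unfolding moved_S by (auto simp: N_def NN)
  obtain x y where xy: "(x, y) \<in> local_pairs" "M \<inter> S = {x, y}"
    using dimer_local_pair[OF M] .
  obtain x' y' where xy': "(x', y') \<in> moved.local_pairs" "M' \<inter> S = {x', y'}"
    using moved.dimer_local_pair[OF M'] unfolding moved_S .
  have MN: "M = N \<union> {x, y}" "M' = N \<union> {x', y'}"
    unfolding xy(2)[symmetric] xy'(2)[symmetric] N_def by (blast, unfold NN, blast)
  have ext: "exterior_dimer (pair_type (x, y)) N" "exterior_dimer (moved.pair_type (x', y')) N"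
    using M M' unfolding MN dimer_iff_exterior[OF xy(1) N(1)] moved.dimer_iff_exterior[OF xy'(1) N(2)]
      exterior_dimer_move .
  have B: "{b\<^sub>1, b\<^sub>2, b\<^sub>3, b\<^sub>4} \<subseteq> blacks G"
    using site_edges by (auto simp: blacks_def)
  have same_type: "pair_type (x, y) = moved.pair_type (x', y')"
  proof (rule exterior_dimer_type_unique[OF ext])
    show "pair_type (x, y) \<subseteq> blacks G"
      using xy(1) B unfolding local_pairs_def by (auto simp: pair_type_simps)
    show "moved.pair_type (x', y') \<subseteq> blacks G"
      using xy'(1) B unfolding moved.local_pairs_def by (auto simp: pair_type_simps)
  qed
  have glue: "(N \<union> {s, t}) \<inter> S = {s, t}" if "s \<in> S" "t \<in> S" for s t
    using that N(1) by blast
  have only: "{s, t} = {x, y}" if "(s, t) \<in> local_pairs" "pair_type (s, t) = pair_type (x, y)" for s t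
  proof -
    have "dimer G (N \<union> {s, t})"
      using ext(1) unfolding dimer_iff_exterior[OF that(1) N(1)] that(2) .
    moreover have "(N \<union> {s, t}) - S = M - S"
      using N(3) local_pairsD(7,8)[OF that(1)] by auto
    ultimately have "N \<union> {s, t} = N \<union> {x, y}"
      using unique MN(1) by metis
    then show ?thesis
      using glue[OF local_pairsD(7,8)[OF that(1)]] glue[OF local_pairsD(7,8)[OF xy(1)]] by simp
  qed
  have only': "{s, t} = {x', y'}" if "(s, t) \<in> moved.local_pairs" "moved.pair_type (s, t) = moved.pair_type (x', y')" for s t
  proof -
    have st: "s \<in> S" "t \<in> S" "x' \<in> S" "y' \<in> S"
      using moved.local_pairsD(7,8)[OF that(1)] moved.local_pairsD(7,8)[OF xy'(1)] unfolding moved_S by auto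
    have "dimer G' (N \<union> {s, t})"
      using ext(2) unfolding moved.dimer_iff_exterior[OF that(1) N(2)] that(2) exterior_dimer_move .
    moreover have "(N \<union> {s, t}) - S = M' - S"
      using N(4) st by auto
    ultimately have "N \<union> {s, t} = N \<union> {x', y'}"
      using unique' MN(2) by metis
    then show ?thesis
      using glue[OF st(1,2)] glue[OF st(3,4)] by simp
  qed
  \<comment> \<open>For the types \<open>{b\<^sub>1, b\<^sub>3}\<close> of \<open>G\<close> and \<open>{b\<^sub>2, b\<^sub>4}\<close> of \<open>G'\<close> a second local pair would violate uniqueness.\<close>
  have "(x, y) \<noteq> (e11, e23)"
    using only[of e13 e21] site_distinct by (auto simp: local_pairs_def pair_type_simps)
  moreover have "(x, y) \<noteq> (e13, e21)"
    using only[of e11 e23] site_distinct by (auto simp: local_pairs_def pair_type_simps)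
  moreover have "(x', y') \<noteq> (e13, e21)"
    using only'[of e24 e12] site_distinct by (auto simp: moved.local_pairs_def pair_type_simps)
  moreover have "(x', y') \<noteq> (e24, e12)"
    using only'[of e13 e21] site_distinct by (auto simp: moved.local_pairs_def pair_type_simps)
  ultimately have "((x, y), (x', y')) \<in> corresponding_pairs"
    by (rule corresponding_pairsI[OF xy(1) xy'(1) same_type])
  moreover have "N \<subseteq> edges G - S"
    using M by (auto simp: N_def dimer_def)
  ultimately show thesis
    using that MN by blast
qed

lemma corresponding_dimersI:
  assumes pairs: "((x, y), (x', y')) \<in> corresponding_pairs" and ext: "exterior_dimer (pair_type (x, y)) N"
  shows "corresponding_dimers G G' S (N \<union> {x, y}) (N \<union> {x', y'})"
proof -
  have N: "N \<inter> S = {}" "N \<inter> {e24, e11, e13, e21, e12, e23} = {}"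
    using ext unfolding exterior_dimer_def moved_S by blast+
  have xy: "(x, y) \<in> local_pairs" "(x', y') \<in> moved.local_pairs"
    and type: "moved.pair_type (x', y') = pair_type (x, y)"
    and only: "\<And>p. p \<in> local_pairs \<Longrightarrow> pair_type p = pair_type (x, y) \<Longrightarrow> p = (x, y)"
    and only': "\<And>p. p \<in> moved.local_pairs \<Longrightarrow> moved.pair_type p = pair_type (x, y) \<Longrightarrow> p = (x', y')"
    using pairs unfolding corresponding_pairs_def local_pairs_def moved.local_pairs_def
    by (auto simp: pair_type_simps doubleton_eq_iff site_blacks)
  have B: "{b\<^sub>1, b\<^sub>2, b\<^sub>3, b\<^sub>4} \<subseteq> blacks G"
    using site_edges by (auto simp: blacks_def)
  have types: "pair_type p \<subseteq> blacks G" if "p \<in> local_pairs" for p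
    using that B unfolding local_pairs_def by (auto simp: pair_type_simps)
  have types': "moved.pair_type p \<subseteq> blacks G" if "p \<in> moved.local_pairs" for p
    using that B unfolding moved.local_pairs_def by (auto simp: pair_type_simps)
  have off: "(N \<union> {x, y}) - S = N" "(N \<union> {x', y'}) - S = N"
  proof -
    have "(N \<union> {s, t}) - S = N" if "s \<in> S" "t \<in> S" for s t
      using that N(1) by blast
    then show "(N \<union> {x, y}) - S = N" "(N \<union> {x', y'}) - S = N"
      using local_pairsD(7,8)[OF xy(1)] moved.local_pairsD(7,8)[OF xy(2)] unfolding moved_S by metis+
  qed
  have unique: "L = N \<union> {x, y}" if L: "dimer G L" "L - S = N" for L
  proof -
    obtain s t where st: "(s, t) \<in> local_pairs" "L \<inter> S = {s, t}"
      using dimer_local_pair[OF L(1)] .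
    have "L = N \<union> {s, t}"
      unfolding st(2)[symmetric] L(2)[symmetric] by blast
    then have "exterior_dimer (pair_type (s, t)) N"
      using L(1) dimer_iff_exterior[OF st(1) N(1)] by simp
    then have "(s, t) = (x, y)"
      using exterior_dimer_type_unique[OF _ ext types[OF st(1)] types[OF xy(1)]] only[OF st(1)] by blast
    then show ?thesis
      using \<open>L = N \<union> {s, t}\<close> by simp
  qed
  have unique': "L = N \<union> {x', y'}" if L: "dimer G' L" "L - S = N" for L
  proof -
    obtain s t where st: "(s, t) \<in> moved.local_pairs" "L \<inter> S = {s, t}"
      using moved.dimer_local_pair[OF L(1)] unfolding moved_S .
    have "L = N \<union> {s, t}"
      unfolding st(2)[symmetric] L(2)[symmetric] by blast
    then have "exterior_dimer (moved.pair_type (s, t)) N"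
      using L(1) moved.dimer_iff_exterior[OF st(1) N(2)] exterior_dimer_move by simp
    then have "(s, t) = (x', y')"
      using exterior_dimer_type_unique[OF _ ext types'[OF st(1)] types[OF xy(1)]] only'[OF st(1)] by blast
    then show ?thesis
      using \<open>L = N \<union> {s, t}\<close> by simp
  qed
  have "dimer G (N \<union> {x, y})" "dimer G' (N \<union> {x', y'})"
    unfolding dimer_iff_exterior[OF xy(1) N(1)] moved.dimer_iff_exterior[OF xy(2) N(2)]
      exterior_dimer_move type by (rule ext)+
  then show ?thesis
    unfolding corresponding_dimers_def off using unique unique' by blast
qed

end

text \<open>
  The rows of the Kasteleyn matrix at \<open>w\<^sub>1, w\<^sub>2\<close> before and after the move, in the notation of
  \<open>three_term_defect\<close>. Each row of one pair, times \<open>u\<close> or \<open>v\<close>, is a combination of the other pair.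
\<close>

lemma row_space_exchange:
  fixes u v x y z w :: complex
  assumes F: "u * v + x * y + z * w = 0" and nz: "u \<noteq> 0" "v \<noteq> 0"
  shows "- y * X\<^sub>1 + u * X\<^sub>2 - z * X\<^sub>3 = 0 \<and> - w * X\<^sub>1 + x * X\<^sub>3 - u * X\<^sub>4 = 0 \<longleftrightarrow>
    v * X\<^sub>1 + x * X\<^sub>2 - z * X\<^sub>4 = 0 \<and> - w * X\<^sub>2 - v * X\<^sub>3 - y * X\<^sub>4 = 0"
    (is "?R\<^sub>1 = 0 \<and> ?R\<^sub>2 = 0 \<longleftrightarrow> ?S\<^sub>1 = 0 \<and> ?S\<^sub>2 = 0")
proof -
  have "u * ?S\<^sub>1 = x * ?R\<^sub>1 + z * ?R\<^sub>2" "u * ?S\<^sub>2 = - w * ?R\<^sub>1 + y * ?R\<^sub>2"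
    "v * ?R\<^sub>1 = - y * ?S\<^sub>1 + z * ?S\<^sub>2" "v * ?R\<^sub>2 = - w * ?S\<^sub>1 - x * ?S\<^sub>2"
    using F by algebra+
  then show ?thesis
    using nz by (metis add_0 diff_0_right mult_eq_0_iff mult_zero_right)
qed

context spider_move_region
begin

context
  fixes K K' :: "nat \<Rightarrow> complex" and u v x y z w :: complex
  assumes K: "K e11 = - y" "K e12 = u" "K e13 = - z" "K e21 = - w" "K e23 = x" "K e24 = - u"
    and K': "K' e11 = v" "K' e13 = x" "K' e24 = - z" "K' e12 = - w" "K' e23 = - v" "K' e21 = - y"
    and off: "\<And>e. e \<notin> S \<Longrightarrow> K' e = K e"
begin

text \<open>
  The two sums run over the configurations of \<open>G\<close> that use \<open>w\<^sub>1b\<^sub>1, w\<^sub>2b\<^sub>3\<close> and \<open>w\<^sub>1b\<^sub>2, w\<^sub>2b\<^sub>4\<close>. They represent the two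
  types \<open>{b\<^sub>1, b\<^sub>3}\<close> and \<open>{b\<^sub>2, b\<^sub>4}\<close>, the only ones in which the minors of \<open>G\<close> and \<open>G'\<close> fail to be proportional.
\<close>

lemma partition_function_defect:
  assumes nz: "\<And>e. e \<in> edges G \<Longrightarrow> K e \<noteq> 0" and nz': "\<And>e. e \<in> edges G' \<Longrightarrow> K' e \<noteq> 0"
    and corr: "corresponding_dimers G G' S M M'"
  shows "face_partition_function G K M - face_partition_function G' K' M' =
    (u * v + x * y + z * w) *
      ((\<Sum>m\<in>dimer_heights_at M (e11, e23). dimer_weight G K m) / (x * y) +
       (\<Sum>m\<in>dimer_heights_at M (e12, e24). dimer_weight G K m) / (u * v))"
proof -
  obtain N x\<^sub>1 y\<^sub>1 x\<^sub>1' y\<^sub>1' where N: "N \<subseteq> edges G - S" and M: "M = N \<union> {x\<^sub>1, y\<^sub>1}" and M': "M' = N \<union> {x\<^sub>1', y\<^sub>1'}"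
    and pairs: "((x\<^sub>1, y\<^sub>1), (x\<^sub>1', y\<^sub>1')) \<in> corresponding_pairs"
    using corresponding_dimers_pairs[OF corr] .
  have p1: "(x\<^sub>1, y\<^sub>1) \<in> local_pairs" and p1': "(x\<^sub>1', y\<^sub>1') \<in> moved.local_pairs"
    and type: "moved.pair_type (x\<^sub>1', y\<^sub>1') = pair_type (x\<^sub>1, y\<^sub>1)"
    using pairs unfolding corresponding_pairs_def local_pairs_def moved.local_pairs_def
    by (auto simp: pair_type_simps)
  define T where "T = pair_type (x\<^sub>1, y\<^sub>1)"
  define V where "V = exterior_sum K N T"
  define P where "P = (\<Prod>e\<in>N. K e)"
  have P': "(\<Prod>e\<in>N. K' e) = P"
    unfolding P_def using N off by (intro prod.cong) auto
  define D where "D = pair_sign (x\<^sub>1, y\<^sub>1) * K x\<^sub>1 * K y\<^sub>1 * P"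
  define D' where "D' = moved.pair_sign (x\<^sub>1', y\<^sub>1') * K' x\<^sub>1' * K' y\<^sub>1' * P"
  have N0: "N \<inter> S = {}" and N0': "N \<inter> {e24, e11, e13, e21, e12, e23} = {}"
    and N': "N \<subseteq> edges G' - {e24, e11, e13, e21, e12, e23}"
    using N unfolding moved_S move_simps(1) by blast+
  have at: "(\<Sum>m\<in>dimer_heights_at M p. dimer_weight G K m) * D =
      pair_sign p * K (fst p) * K (snd p) * V (pair_type p)" if "p \<in> local_pairs" for p
    unfolding M D_def P_def V_def T_def by (rule dimer_heights_at_sum[where K = K, OF nz p1 N that])
  have at': "(\<Sum>m\<in>moved.dimer_heights_at M' p. dimer_weight G' K' m) * D' =
      moved.pair_sign p * K' (fst p) * K' (snd p) * (b2_sign (moved.pair_type p) * b2_sign T * V (moved.pair_type p))"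
    if "p \<in> moved.local_pairs" for p
  proof -
    have "(\<Sum>m\<in>moved.dimer_heights_at M' p. dimer_weight G' K' m) * D' =
        moved.pair_sign p * K' (fst p) * K' (snd p) * moved.exterior_sum K' N T (moved.pair_type p)"
      unfolding M' D'_def P'[symmetric] T_def type[symmetric]
      by (rule moved.dimer_heights_at_sum[OF _ p1' N' that]) (rule nz')
    also have "moved.exterior_sum K' N T (moved.pair_type p) =
        b2_sign (moved.pair_type p) * b2_sign T * V (moved.pair_type p)"
      unfolding V_def by (rule exterior_sum_move) (rule off)
    finally show ?thesis .
  qed
  have fin: "finite (dimer_heights G M)"
    by (rule finite_dimer_heights[OF planar])
  \<comment> \<open>Both graphs realise the same types, so the finiteness of the exteriors carries over to \<open>G'\<close>.\<close>
  have types: "moved.pair_type ` moved.local_pairs = pair_type ` local_pairs"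
  proof -
    have "{A, B, C, D, E, E, F} = {C, A, D, B, F, F, E}" for A B C D E F :: "nat set"
      by blast
    then show ?thesis
      unfolding local_pairs_def moved.local_pairs_def image_insert image_empty pair_type_simps .
  qed
  have "\<forall>U\<in>pair_type ` local_pairs. finite (exterior N (pair_type (x\<^sub>1, y\<^sub>1)) U)"
    using fin unfolding M finite_dimer_heights_iff_exterior[OF p1 N0] by simp
  then have fin': "finite (dimer_heights G' M')"
    unfolding M' moved.finite_dimer_heights_iff_exterior[OF p1' N0'] exterior_move type
      types[symmetric] by simp
  have sites: "(e11, e23) \<in> local_pairs" "(e12, e24) \<in> local_pairs"
    by (simp_all add: local_pairs_def)
  have "face_partition_function G K M * D =
      (\<Sum>p\<in>local_pairs. pair_sign p * K (fst p) * K (snd p) * V (pair_type p))"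
    unfolding face_partition_function_split[OF fin]
    by (subst sum_distrib_right) (rule sum.cong[OF refl at])
  also have "\<dots> = - (u * w) * V {b\<^sub>1, b\<^sub>2} + u * y * V {b\<^sub>1, b\<^sub>4} + u * x * V {b\<^sub>2, b\<^sub>3} - u * z * V {b\<^sub>3, b\<^sub>4}
      - (x * y + z * w) * V {b\<^sub>1, b\<^sub>3} - u * u * V {b\<^sub>2, b\<^sub>4}"
    unfolding local_pairs_def
    by (simp add: site_distinct pair_type_simps pair_sign_def K) (simp add: algebra_simps)
  finally have Z: "face_partition_function G K M * D = \<dots>" .
  have "face_partition_function G' K' M' * D' =
      (\<Sum>p\<in>moved.local_pairs. moved.pair_sign p * K' (fst p) * K' (snd p) *
        (b2_sign (moved.pair_type p) * b2_sign T * V (moved.pair_type p)))"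
    unfolding moved.face_partition_function_split[OF fin']
    by (subst sum_distrib_right) (rule sum.cong[OF refl at'])
  then have "face_partition_function G' K' M' * (b2_sign T * D') =
      b2_sign T * (\<Sum>p\<in>moved.local_pairs. moved.pair_sign p * K' (fst p) * K' (snd p) *
        (b2_sign (moved.pair_type p) * b2_sign T * V (moved.pair_type p)))"
    by (simp only: mult.left_commute)
  also have "\<dots> = v * w * V {b\<^sub>1, b\<^sub>2} - v * y * V {b\<^sub>1, b\<^sub>4} - v * x * V {b\<^sub>2, b\<^sub>3} + v * z * V {b\<^sub>3, b\<^sub>4}
      - v * v * V {b\<^sub>1, b\<^sub>3} - (x * y + z * w) * V {b\<^sub>2, b\<^sub>4}"
  proof -
    have "b2_sign T = 1 \<or> b2_sign T = - 1"
      by (simp add: b2_sign_def)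
    then show ?thesis
      unfolding moved.local_pairs_def
      by (rule disjE) (simp_all add: site_distinct pair_type_simps pair_sign_def K' b2_sign_def site_blacks,
        simp_all add: algebra_simps)
  qed
  finally have Z': "face_partition_function G' K' M' * (b2_sign T * D') = \<dots>" .
  have ratio: "u * (b2_sign T * D') = - (v * D)"
    using pairs unfolding corresponding_pairs_def D_def D'_def T_def
    by (auto simp: pair_type_simps pair_sign_def K K' b2_sign_def site_distinct site_blacks)
  have E: "e \<in> S \<Longrightarrow> e \<in> edges G" "e \<in> S \<Longrightarrow> e \<in> edges G'" for e
    using site_edges unfolding move_simps(1) by blast+
  have nonzero: "u \<noteq> 0" "v \<noteq> 0" "x \<noteq> 0" "y \<noteq> 0"
    using nz[of e12] nz'[of e11] nz[of e23] nz[of e11] E K K' by auto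
  have NE: "N \<subseteq> edges G"
    using N by blast
  then have "P \<noteq> 0"
    unfolding P_def using nz finite_subset[OF NE finite_edges] by auto
  moreover have "K x\<^sub>1 \<noteq> 0" "K y\<^sub>1 \<noteq> 0"
    using nz E(1) local_pairsD(7,8)[OF p1] by blast+
  ultimately have "D \<noteq> 0"
    by (simp add: D_def pair_sign_def)
  have A: "(\<Sum>m\<in>dimer_heights_at M (e11, e23). dimer_weight G K m) * D = - (x * y) * V {b\<^sub>1, b\<^sub>3}"
    unfolding at[OF sites(1)] by (simp add: pair_type_simps pair_sign_def K site_distinct)
  have B: "(\<Sum>m\<in>dimer_heights_at M (e12, e24). dimer_weight G K m) * D = - (u * u) * V {b\<^sub>2, b\<^sub>4}"
    unfolding at[OF sites(2)] by (simp add: pair_type_simps pair_sign_def K site_distinct)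
  show ?thesis
    by (rule three_term_defect[OF Z Z' ratio A B \<open>D \<noteq> 0\<close> nonzero])
qed

text \<open>
  The equations at white vertices other than \<open>w\<^sub>1, w\<^sub>2\<close> do not change, and the other two are exchanged
  for equivalent ones.
\<close>

lemma kernel_move:
  assumes F: "u * v + x * y + z * w = 0" and nz: "u \<noteq> 0" "v \<noteq> 0"
  shows "kasteleyn_kernel G K = kasteleyn_kernel G' K'"
proof -
  have far: "(\<Sum>e | e \<in> edges G' \<and> white_of G' e = l. K' e * X (black_of G' e)) =
      (\<Sum>e | e \<in> edges G \<and> white_of G e = l. K e * X (black_of G e))"
    if l: "l \<in> whites G - {w\<^sub>1, w\<^sub>2}" for l and X :: "nat \<Rightarrow> complex"
  proof (rule sum.cong)
    have "e \<notin> S" if "white_of G e = l \<or> white_of G' e = l" for e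
    proof
      assume "e \<in> S"
      then have "white_of G e \<in> {w\<^sub>1, w\<^sub>2}" "white_of G' e \<in> {w\<^sub>1, w\<^sub>2}"
        using white_of_move site_whites by auto
      then show False
        using that l by auto
    qed
    then show "{e. e \<in> edges G' \<and> white_of G' e = l} = {e. e \<in> edges G \<and> white_of G e = l}"
      unfolding move_simps(1) using move_off_S(1) by metis
    show "K' e * X (black_of G' e) = K e * X (black_of G e)"
      if "e \<in> {e. e \<in> edges G \<and> white_of G e = l}" for e
      using that l site_edge_iff[of e] by (simp add: off move_off_S(2))
  qed
  have near: "(\<Sum>e | e \<in> edges G \<and> white_of G e = w\<^sub>1. K e * X (black_of G e)) = - y * X b\<^sub>1 + u * X b\<^sub>2 - z * X b\<^sub>3"
    "(\<Sum>e | e \<in> edges G \<and> white_of G e = w\<^sub>2. K e * X (black_of G e)) = - w * X b\<^sub>1 + x * X b\<^sub>3 - u * X b\<^sub>4"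
    for X :: "nat \<Rightarrow> complex"
    unfolding edges_w1 edges_w2 by (simp_all add: site_distinct K black_shared)
  have near': "(\<Sum>e | e \<in> edges G' \<and> white_of G' e = w\<^sub>1. K' e * X (black_of G' e)) = v * X b\<^sub>1 + x * X b\<^sub>2 - z * X b\<^sub>4"
    "(\<Sum>e | e \<in> edges G' \<and> white_of G' e = w\<^sub>2. K' e * X (black_of G' e)) = - w * X b\<^sub>2 - v * X b\<^sub>3 - y * X b\<^sub>4"
    for X :: "nat \<Rightarrow> complex"
    unfolding moved.edges_w1[unfolded white_of_move] moved.edges_w2[unfolded white_of_move]
    by (simp_all add: site_distinct K' black_of_move)
  have split: "(\<forall>l\<in>whites G. Q l) \<longleftrightarrow> (\<forall>l\<in>whites G - {w\<^sub>1, w\<^sub>2}. Q l) \<and> Q w\<^sub>1 \<and> Q w\<^sub>2" for Q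
    using site_edges by (auto simp: whites_def)
  show ?thesis
    unfolding kasteleyn_kernel_def whites_move blacks_move split near near'
      row_space_exchange[OF F nz]
    by (simp only: far cong: ball_cong)
qed

end

end

section \<open>The cube graph\<close>

text \<open>
  The cube, with \<open>w\<^sub>1, w\<^sub>2\<close> the first two of its white vertices \<open>0, 1, 2, 3\<close> and with three edges numbered
  consecutively at each of them. Both rotations consist of three-cycles. The edges \<open>0, 1, 2, 3, 4, 5\<close> take the
  places of \<open>e11, e12, e13, e21, e23, e24\<close>.
\<close>

\<comment> \<open>Keeps the edge label \<open>1\<close> from being rewritten to \<open>Suc 0\<close>.\<close>
declare One_nat_def [simp del]

lemma dimerI:
  assumes "M \<subseteq> edges G" and "bij_betw (white_of G) M (whites G)" and "bij_betw (black_of G) M (blacks G)"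
  shows "dimer G M"
proof -
  have "\<exists>!e. e \<in> M \<and> p e = v" if "bij_betw p M V" "v \<in> V" for p :: "nat \<Rightarrow> nat" and V v
    using that unfolding bij_betw_def inj_on_def by blast
  then show ?thesis
    using assms unfolding dimer_def by (intro conjI ballI)
qed

lemma dimer_inj:
  assumes "dimer G M" and "e \<in> M" and "e' \<in> M" and "white_of G e = white_of G e' \<or> black_of G e = black_of G e'"
  shows "e = e'"
proof -
  have M: "M \<subseteq> edges G" and w: "\<forall>w\<in>whites G. \<exists>!e. e \<in> M \<and> white_of G e = w"
    and b: "\<forall>b\<in>blacks G. \<exists>!e. e \<in> M \<and> black_of G e = b"
    using assms(1) unfolding dimer_def by auto
  have "white_of G e \<in> whites G" "black_of G e \<in> blacks G"
    using M assms(2) by (auto simp: whites_def blacks_def)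
  then have "\<exists>!e'. e' \<in> M \<and> white_of G e' = white_of G e" "\<exists>!e'. e' \<in> M \<and> black_of G e' = black_of G e"
    using w b by (simp_all only: Ball_def)
  then show ?thesis
    using assms(2-4) by (elim ex1E) metis
qed

lemma three_cycles_permute:
  assumes "\<forall>x\<in>A. p (p (p x)) = x" and "\<forall>x\<in>A. p x \<in> A" and "\<And>x. x \<notin> A \<Longrightarrow> p x = x"
  shows "p permutes A"
  by (rule bij_imp_permutes, rule bij_betw_byWitness[where f' = "\<lambda>x. p (p x)"]) (use assms in auto)

definition cube_rotW :: "nat \<Rightarrow> nat" where
  "cube_rotW e = (if e < 12 then [1, 2, 0, 4, 5, 3, 7, 8, 6, 10, 11, 9] ! e else e)"

definition cube_rotB :: "nat \<Rightarrow> nat" where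
  "cube_rotB e = (if e < 12 then [3, 8, 10, 6, 2, 9, 0, 5, 11, 7, 4, 1] ! e else e)"

definition cube_black :: "nat \<Rightarrow> nat" where
  "cube_black e = [0, 1, 2, 0, 2, 3, 0, 3, 1, 3, 2, 1] ! e"

definition cube :: bgraph where
  "cube = \<lparr>edges = {0, 1, 2, 3, 4, 5, 6, 7, 8, 9, 10, 11}, white_of = \<lambda>e. e div 3, black_of = cube_black,
     rotW = cube_rotW, rotB = cube_rotB, outer = {4, 9}\<rparr>"

lemma cube_simps:
  "edges cube = {0, 1, 2, 3, 4, 5, 6, 7, 8, 9, 10, 11}" "white_of cube e = e div 3"
  "black_of cube = cube_black" "rotW cube = cube_rotW" "rotB cube = cube_rotB" "outer cube = {4, 9}"
  by (simp_all add: cube_def)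

lemma cube_values:
  "cube_rotW 0 = 1" "cube_rotW 1 = 2" "cube_rotW 2 = 0" "cube_rotW 3 = 4" "cube_rotW 4 = 5" "cube_rotW 5 = 3"
  "cube_rotW 6 = 7" "cube_rotW 7 = 8" "cube_rotW 8 = 6" "cube_rotW 9 = 10" "cube_rotW 10 = 11" "cube_rotW 11 = 9"
  "cube_rotB 0 = 3" "cube_rotB 1 = 8" "cube_rotB 2 = 10" "cube_rotB 3 = 6" "cube_rotB 4 = 2" "cube_rotB 5 = 9"
  "cube_rotB 6 = 0" "cube_rotB 7 = 5" "cube_rotB 8 = 11" "cube_rotB 9 = 7" "cube_rotB 10 = 4" "cube_rotB 11 = 1"
  "cube_black 0 = 0" "cube_black 1 = 1" "cube_black 2 = 2" "cube_black 3 = 0" "cube_black 4 = 2" "cube_black 5 = 3"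
  "cube_black 6 = 0" "cube_black 7 = 3" "cube_black 8 = 1" "cube_black 9 = 3" "cube_black 10 = 2" "cube_black 11 = 1"
  by (simp_all add: cube_rotW_def cube_rotB_def cube_black_def One_nat_def)

lemma cube_left_face:
  "left_face cube 0 = {0, 8}" "left_face cube 1 = {1, 10}" "left_face cube 2 = {2, 3}"
  "left_face cube 3 = {2, 3}" "left_face cube 4 = {4, 9}" "left_face cube 5 = {5, 6}"
  "left_face cube 6 = {5, 6}" "left_face cube 7 = {7, 11}" "left_face cube 8 = {0, 8}"
  "left_face cube 9 = {4, 9}" "left_face cube 10 = {1, 10}" "left_face cube 11 = {7, 11}"
  unfolding left_face_def by (subst orbit_two_cycle; simp add: cube_simps cube_values insert_commute)+

lemma cube_faces: "faces cube = {{0, 8}, {1, 10}, {2, 3}, {4, 9}, {5, 6}, {7, 11}}"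
proof -
  have "{A, B, C, C, D, E, E, F, A, D, B, F} = {A, B, C, D, E, F}" for A B C D E F :: "nat set"
    by (intro equalityI subsetI; elim insertE emptyE; simp only: insert_iff simp_thms)
  then show ?thesis
    unfolding faces_def cube_simps image_insert image_empty cube_left_face .
qed

lemma cube_whites: "whites cube = {0, 1, 2, 3}"
  unfolding whites_def cube_simps image_insert image_empty by auto

lemma cube_blacks: "blacks cube = {0, 1, 2, 3}"
  unfolding blacks_def cube_simps image_insert image_empty cube_values by auto

lemma cube_planar: "planar_bipartite cube"
  unfolding planar_bipartite_def
proof (intro conjI allI impI)
  let ?E = "{0, 1, 2, 3, 4, 5, 6, 7, 8, 9, 10, 11} :: nat set"
  have W3: "\<forall>e\<in>?E. cube_rotW (cube_rotW (cube_rotW e)) = e" and B3: "\<forall>e\<in>?E. cube_rotB (cube_rotB (cube_rotB e)) = e"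
    by (simp_all add: cube_values)
  have W: "\<forall>e\<in>?E. cube_rotW e \<in> ?E" and B: "\<forall>e\<in>?E. cube_rotB e \<in> ?E"
    by (simp_all add: cube_values)
  have out: "cube_rotW e = e" "cube_rotB e = e" if "e \<notin> ?E" for e
  proof -
    have "\<not> e < 12"
      using that unfolding insert_iff empty_iff by presburger
    then show "cube_rotW e = e" "cube_rotB e = e"
      by (simp_all add: cube_rotW_def cube_rotB_def)
  qed
  show "rotW cube permutes edges cube"
    unfolding cube_simps
    by (rule three_cycles_permute[OF W3 W out(1)])
  show "rotB cube permutes edges cube"
    unfolding cube_simps
    by (rule three_cycles_permute[OF B3 B out(2)])
  have W_orbit: "orbit cube_rotW e = {e, cube_rotW e, cube_rotW (cube_rotW e)}" if "e \<in> ?E" for e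
    by (rule orbit_three_cycle[where p = cube_rotW, OF bspec[OF W3 that]])
  have B_orbit: "orbit cube_rotB e = {e, cube_rotB e, cube_rotB (cube_rotB e)}" if "e \<in> ?E" for e
    by (rule orbit_three_cycle[where p = cube_rotB, OF bspec[OF B3 that]])
  show "\<forall>e\<in>edges cube. \<forall>e'\<in>edges cube. white_of cube e = white_of cube e' \<longleftrightarrow> e' \<in> orbit (rotW cube) e"
    unfolding cube_simps by (simp add: W_orbit cube_values)
  show "\<forall>e\<in>edges cube. \<forall>e'\<in>edges cube. black_of cube e = black_of cube e' \<longleftrightarrow> e' \<in> orbit (rotB cube) e"
    unfolding cube_simps by (simp add: B_orbit cube_values)
  show "card (whites cube) + card (blacks cube) + card (faces cube) = card (edges cube) + 2"
    unfolding cube_whites cube_blacks cube_faces cube_simps by (simp add: doubleton_eq_iff)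
  show "outer cube \<in> faces cube"
    unfolding cube_faces cube_simps by simp
  fix A assume A: "A \<subseteq> edges cube \<and> A \<noteq> {} \<and> rotW cube ` A \<subseteq> A \<and> rotB cube ` A \<subseteq> A"
  then have step: "e \<in> A \<Longrightarrow> cube_rotW e \<in> A" "e \<in> A \<Longrightarrow> cube_rotB e \<in> A" for e
    by (auto simp: cube_simps)
  have W_iff: "x \<in> A \<longleftrightarrow> cube_rotW x \<in> A" and B_iff: "x \<in> A \<longleftrightarrow> cube_rotB x \<in> A" if "x \<in> ?E" for x
    using step[of x] step[of "cube_rotW x"] step[of "cube_rotW (cube_rotW x)"]
      step[of "cube_rotB x"] step[of "cube_rotB (cube_rotB x)"] W3 B3 that by metis+
  \<comment> \<open>These twelve steps link every edge to the edge \<open>0\<close>.\<close>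
  have all: "\<forall>x\<in>edges cube. x \<in> A \<longleftrightarrow> 0 \<in> A"
    unfolding cube_simps
    using W_iff[of 0] W_iff[of 1] W_iff[of 3] W_iff[of 4] W_iff[of 6] W_iff[of 7] W_iff[of 9] W_iff[of 10]
      B_iff[of 0] B_iff[of 3] B_iff[of 1] B_iff[of 8] by (simp add: cube_values)
  have sub: "A \<subseteq> edges cube" and "A \<noteq> {}"
    using A by blast+
  then obtain x where x: "x \<in> A"
    by blast
  then have "0 \<in> A"
    using all subsetD[OF sub x] by blast
  then show "A = edges cube"
    using all sub by blast
qed (simp_all add: cube_simps)

lemma cube_right_face:
  "right_face cube 0 = {2, 3}" "right_face cube 1 = {0, 8}" "right_face cube 2 = {1, 10}"
  "right_face cube 3 = {5, 6}" "right_face cube 4 = {2, 3}" "right_face cube 5 = {4, 9}"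
  "right_face cube 6 = {0, 8}" "right_face cube 7 = {5, 6}" "right_face cube 8 = {7, 11}"
  "right_face cube 9 = {7, 11}" "right_face cube 10 = {4, 9}" "right_face cube 11 = {1, 10}"
  by (simp_all add: right_face_def cube_simps cube_values cube_left_face)

lemma cube_site: "spider_site cube 0 1 2 3 4 5"
  unfolding spider_site_def cube_simps by (simp add: cube_values doubleton_eq_iff)

interpretation cube: spider_move_region cube 0 1 2 3 4 5
  by (rule planar_spider_move_region[OF cube_planar cube_site])

lemma cube_trivalent: "white_trivalent cube"
proof -
  have "{e \<in> edges cube. white_of cube e = w} = {3 * w, 3 * w + 1, 3 * w + 2}" if "w \<in> {0, 1, 2, 3}" for w
    using that unfolding cube_simps by auto
  then show ?thesis
    unfolding white_trivalent_def cube_whites by simp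
qed

text \<open>
  The reference matches \<open>w\<^sub>1, w\<^sub>2\<close> with \<open>b\<^sub>2, b\<^sub>1\<close>, which are neighbours.
\<close>

lemma cube_reference:
  "corresponding_dimers cube (spider_move cube 0 1 2 3 4 5) {0, 1, 2, 3, 4, 5} {7, 10, 1, 3} {7, 10, 0, 1}"
proof -
  have "cube.exterior_dimer (cube.pair_type (1, 3)) {7, 10}"
    unfolding cube.exterior_dimer_def cube.pair_type_def cube_whites cube_blacks cube_simps
    by (simp add: cube_values) (auto simp: cube_values)
  moreover have "((1, 3), (0, 1)) \<in> cube.corresponding_pairs"
    by (simp add: cube.corresponding_pairs_def)
  ultimately show ?thesis
    using cube.corresponding_dimersI[of 1 3 0 1 "{7, 10}"] by (simp add: insert_commute)
qed

definition cube_height :: "nat set set \<Rightarrow> int \<Rightarrow> nat set \<Rightarrow> int" where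
  "cube_height \<F> k F = (if F \<in> \<F> then k else 0)"

lemma cube_dimers: "dimer cube {0, 4, 7, 11}" "dimer cube {0, 4, 8, 9}" "dimer cube {1, 5, 6, 10}"
  by (rule dimerI; unfold cube_whites cube_blacks cube_simps bij_betw_def; auto simp: cube_values)+

text \<open>
  The height functions follow from walking around the faces, starting from height \<open>0\<close> on the unbounded face
  \<open>{4, 9}\<close>.
\<close>

lemma cube_heights:
  "height_function cube {7, 10, 1, 3} {0, 4, 7, 11} (cube_height {{2, 3}, {1, 10}} (- 1))"
  "height_function cube {7, 10, 1, 3} {0, 4, 8, 9} (cube_height {{2, 3}, {1, 10}, {7, 11}} (- 1))"
  "height_function cube {7, 10, 1, 3} {1, 5, 6, 10} (cube_height {{5, 6}} 1)"
  unfolding height_function_def cube_faces cube_simps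
  by (simp_all add: cube_height_def cube_left_face cube_right_face doubleton_eq_iff)

lemma cube_dimer_13:
  assumes M: "dimer cube M" and "0 \<in> M" "4 \<in> M"
  shows "M = {0, 4, 7, 11} \<or> M = {0, 4, 8, 9}"
proof -
  have E: "M \<subseteq> {0, 1, 2, 3, 4, 5, 6, 7, 8, 9, 10, 11}"
    using M unfolding dimer_def cube_simps by blast
  have inj: "e = e'" if "e \<in> M" "e' \<in> M" "e div 3 = e' div 3 \<or> cube_black e = cube_black e'" for e e'
    using dimer_inj[OF M that(1,2)] that(3) unfolding cube_simps by blast
  have no: "1 \<notin> M" "2 \<notin> M" "3 \<notin> M" "5 \<notin> M" "6 \<notin> M" "10 \<notin> M"
    using inj[of 0 1] inj[of 0 2] inj[of 0 3] inj[of 4 5] inj[of 0 6] inj[of 4 10] assms(2,3)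
    by (auto simp: cube_values)
  have excl: "\<not> (7 \<in> M \<and> 8 \<in> M)" "\<not> (9 \<in> M \<and> 11 \<in> M)" "\<not> (7 \<in> M \<and> 9 \<in> M)" "\<not> (8 \<in> M \<and> 11 \<in> M)"
    using inj[of 7 8] inj[of 9 11] inj[of 7 9] inj[of 8 11] by (auto simp: cube_values)
  have ex: "\<exists>e\<in>M. e div 3 = w" if "w \<in> {0, 1, 2, 3}" for w
    using M that unfolding dimer_def cube_whites cube_simps by blast
  have "7 \<in> M \<or> 8 \<in> M"
    using ex[of 2] E no by auto
  moreover have "9 \<in> M \<or> 11 \<in> M"
    using ex[of 3] E no by auto
  ultimately have "7 \<in> M \<and> 11 \<in> M \<and> 8 \<notin> M \<and> 9 \<notin> M \<or> 8 \<in> M \<and> 9 \<in> M \<and> 7 \<notin> M \<and> 11 \<notin> M"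
    using excl by blast
  then show ?thesis
  proof (elim disjE conjE)
    assume "7 \<in> M" "11 \<in> M" "8 \<notin> M" "9 \<notin> M"
    then have "{0, 1, 2, 3, 4, 5, 6, 7, 8, 9, 10, 11} \<inter> M = {0, 4, 7, 11}"
      using no assms(2,3) by simp
    then show ?thesis
      unfolding Int_absorb1[OF E] by (rule disjI1)
  next
    assume "8 \<in> M" "9 \<in> M" "7 \<notin> M" "11 \<notin> M"
    then have "{0, 1, 2, 3, 4, 5, 6, 7, 8, 9, 10, 11} \<inter> M = {0, 4, 8, 9}"
      using no assms(2,3) by simp
    then show ?thesis
      unfolding Int_absorb1[OF E] by (rule disjI2)
  qed
qed

lemma cube_dimer_24:
  assumes M: "dimer cube M" and "1 \<in> M" "5 \<in> M"
  shows "M = {1, 5, 6, 10}"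
proof -
  have E: "M \<subseteq> {0, 1, 2, 3, 4, 5, 6, 7, 8, 9, 10, 11}"
    using M unfolding dimer_def cube_simps by blast
  have inj: "e = e'" if "e \<in> M" "e' \<in> M" "e div 3 = e' div 3 \<or> cube_black e = cube_black e'" for e e'
    using dimer_inj[OF M that(1,2)] that(3) unfolding cube_simps by blast
  have no: "0 \<notin> M" "2 \<notin> M" "3 \<notin> M" "4 \<notin> M" "7 \<notin> M" "8 \<notin> M" "9 \<notin> M" "11 \<notin> M"
    using inj[of 1 0] inj[of 1 2] inj[of 5 3] inj[of 5 4] inj[of 5 7] inj[of 1 8] inj[of 5 9] inj[of 1 11] assms(2,3)
    by (auto simp: cube_values)
  have ex: "\<exists>e\<in>M. e div 3 = w" if "w \<in> {0, 1, 2, 3}" for w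
    using M that unfolding dimer_def cube_whites cube_simps by blast
  have "6 \<in> M"
    using ex[of 2] E no by auto
  moreover have "10 \<in> M"
    using ex[of 3] E no by auto
  ultimately have "{0, 1, 2, 3, 4, 5, 6, 7, 8, 9, 10, 11} \<inter> M = {1, 5, 6, 10}"
    using no assms(2,3) by simp
  then show ?thesis
    unfolding Int_absorb1[OF E] .
qed

lemma cube_dimer_heights_13:
  "cube.dimer_heights_at {7, 10, 1, 3} (0, 4) =
    {({0, 4, 7, 11}, cube_height {{2, 3}, {1, 10}} (- 1)),
     ({0, 4, 8, 9}, cube_height {{2, 3}, {1, 10}, {7, 11}} (- 1))}" (is "?L = ?R")
proof (intro equalityI subsetI)
  fix m assume "m \<in> ?L"
  then obtain M h where m: "m = (M, h)" "dimer cube M" "height_function cube {7, 10, 1, 3} M h" "0 \<in> M" "4 \<in> M"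
    by (auto simp: cube.dimer_heights_at_def)
  show "m \<in> ?R"
    using cube_dimer_13[OF m(2,4,5)]
  proof (elim disjE)
    assume M: "M = {0, 4, 7, 11}"
    show ?thesis
      unfolding m(1) M height_function_unique[OF cube_planar m(3)[unfolded M] cube_heights(1)] by (rule insertI1)
  next
    assume M: "M = {0, 4, 8, 9}"
    show ?thesis
      unfolding m(1) M height_function_unique[OF cube_planar m(3)[unfolded M] cube_heights(2)]
      by (rule insertI2[OF insertI1])
  qed
next
  fix m assume "m \<in> ?R"
  then show "m \<in> ?L"
    unfolding cube.dimer_heights_at_def using cube_dimers cube_heights by auto
qed

lemma cube_dimer_heights_24:
  "cube.dimer_heights_at {7, 10, 1, 3} (1, 5) = {({1, 5, 6, 10}, cube_height {{5, 6}} 1)}" (is "?L = ?R")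
proof (intro equalityI subsetI)
  fix m assume "m \<in> ?L"
  then obtain M h where m: "m = (M, h)" "dimer cube M" "height_function cube {7, 10, 1, 3} M h" "1 \<in> M" "5 \<in> M"
    by (auto simp: cube.dimer_heights_at_def)
  show "m \<in> ?R"
    unfolding m(1) cube_dimer_24[OF m(2,4,5)]
      height_function_unique[OF cube_planar m(3)[unfolded cube_dimer_24[OF m(2,4,5)]] cube_heights(3)]
    by (rule insertI1)
next
  fix m assume "m \<in> ?R"
  then show "m \<in> ?L"
    unfolding cube.dimer_heights_at_def using cube_dimers cube_heights by auto
qed

text \<open>
  The sums that enter the defect. The signs are those of \<open>(- 1)\<close> to the total height, since all faces of the
  cube are quadrangles.
\<close>

lemma cube_weights:
  assumes nz: "\<And>e. e \<in> edges cube \<Longrightarrow> K e \<noteq> 0"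
  defines "D \<equiv> K 1 * K 3 * K 7 * K 10"
  shows "(\<Sum>m\<in>cube.dimer_heights_at {7, 10, 1, 3} (0, 4). dimer_weight cube K m) =
      (K 0 * K 4 * K 7 * K 11 - K 0 * K 4 * K 8 * K 9) / D" (is ?A)
    and "(\<Sum>m\<in>cube.dimer_heights_at {7, 10, 1, 3} (1, 5). dimer_weight cube K m) =
      - (K 1 * K 5 * K 6 * K 10) / D" (is ?B)
proof -
  have rot: "rotB cube e \<in> edges cube" if "e \<in> edges cube" for e
    using that permutes_in_image[OF cube.rotB_permutes] by simp
  have weight: "dimer_weight cube K (M, h) =
      face_sign (faces cube) h * ((\<Prod>e\<in>M. K e) / (\<Prod>e\<in>{7, 10, 1, 3}. K e))"
    if "dimer cube M" "height_function cube {7, 10, 1, 3} M h" for M h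
    unfolding dimer_weight_def prod.case
  proof (rule face_weights_edge_weights[OF cube.finite_edges rot nz _ _ that(2)])
    show "M \<subseteq> edges cube"
      using that(1) by (simp add: dimer_def)
  qed (simp_all add: cube_simps)
  have sign: "face_sign (faces cube) (cube_height {{2, 3}, {1, 10}} (- 1)) = 1"
    "face_sign (faces cube) (cube_height {{2, 3}, {1, 10}, {7, 11}} (- 1)) = - 1"
    "face_sign (faces cube) (cube_height {{5, 6}} 1) = - 1"
    unfolding face_sign_def cube_faces by (simp_all add: cube_height_def doubleton_eq_iff)
  have prods: "(\<Prod>e\<in>{7, 10, 1, 3}. K e) = D" "(\<Prod>e\<in>{0, 4, 7, 11}. K e) = K 0 * K 4 * K 7 * K 11"
    "(\<Prod>e\<in>{0, 4, 8, 9}. K e) = K 0 * K 4 * K 8 * K 9"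
    "(\<Prod>e\<in>{1, 5, 6, 10}. K e) = K 1 * K 5 * K 6 * K 10"
    by (simp_all add: D_def)
  note weights = weight[OF cube_dimers(1) cube_heights(1)] weight[OF cube_dimers(2) cube_heights(2)]
    weight[OF cube_dimers(3) cube_heights(3)]
  have "(\<Sum>m\<in>{({0, 4, 7, 11}, g), ({0, 4, 8, 9}, h)}. dimer_weight cube K m) =
      dimer_weight cube K ({0, 4, 7, 11}, g) + dimer_weight cube K ({0, 4, 8, 9}, h)" for g h
    by (simp add: set_eq_subset)
  then show ?A
    unfolding cube_dimer_heights_13 by (simp only: weights sign prods) (simp add: diff_divide_distrib)
  show ?B
    unfolding cube_dimer_heights_24 by (simp add: weights sign prods del: prod.insert)
qed

section \<open>The equivalence\<close>

definition three_term :: "(complex \<Rightarrow> complex \<Rightarrow> complex) \<Rightarrow> complex \<Rightarrow> complex \<Rightarrow> complex \<Rightarrow> complex \<Rightarrow> complex" where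
  "three_term h a b c d = h a b * h c d + h a c * h d b + h a d * h b c"

text \<open>
  Antisymmetry brings the twelve coefficients into the six values \<open>h a b\<close>, \<open>h c d\<close>, \<open>h a c\<close>, \<open>h d b\<close>, \<open>h a d\<close>,
  \<open>h b c\<close> that make up the three products of the relation.
\<close>

lemma spider_coefficients_antisymmetric:
  fixes H :: "complex \<Rightarrow> complex \<Rightarrow> complex \<Rightarrow> complex"
  assumes anti: "\<And>t \<alpha> \<beta>. H t \<beta> \<alpha> = - H t \<alpha> \<beta>"
    and G: "planar_bipartite G" "spider_site G e11 e12 e13 e21 e23 e24" "track_parameters G \<alpha> \<beta>"
    and t: "t (white_of G e11) = t (white_of G e21)"
  defines "h \<equiv> H (t (white_of G e11))"
    and "a \<equiv> \<alpha> e13" and "b \<equiv> \<alpha> e12" and "c \<equiv> \<alpha> e23" and "d \<equiv> \<alpha> e11"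
    and "K \<equiv> kasteleyn H t G \<alpha> \<beta>"
    and "K' \<equiv> spider_kasteleyn H t G \<alpha> \<beta> e11 e12 e13 e21 e23 e24"
  shows "K e11 = - h d b" "K e12 = h a b" "K e13 = - h a d" "K e21 = - h b c" "K e23 = h a c" "K e24 = - h a b"
    and "K' e11 = h c d" "K' e13 = h a c" "K' e24 = - h a d" "K' e12 = - h b c" "K' e23 = - h c d" "K' e21 = - h d b"
    and "\<And>e. e \<notin> {e11, e12, e13, e21, e23, e24} \<Longrightarrow> K' e = K e"
proof -
  note coeff = spider_kasteleyn_coefficients[OF G refl t[symmetric] a_def[THEN meta_eq_to_obj_eq]
      b_def[THEN meta_eq_to_obj_eq] c_def[THEN meta_eq_to_obj_eq] d_def[THEN meta_eq_to_obj_eq],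
      where H = H, folded K_def K'_def h_def]
  show "K e11 = - h d b" "K e12 = h a b" "K e13 = - h a d" "K e21 = - h b c" "K e23 = h a c" "K e24 = - h a b"
    "K' e11 = h c d" "K' e13 = h a c" "K' e24 = - h a d" "K' e12 = - h b c" "K' e23 = - h c d" "K' e21 = - h d b"
    unfolding coeff(1-12) h_def by (rule anti refl)+
  show "K' e = K e" if "e \<notin> {e11, e12, e13, e21, e23, e24}" for e
    using that by (rule coeff(13))
qed

lemma three_term_imp_invariant:
  fixes H :: "complex \<Rightarrow> complex \<Rightarrow> complex \<Rightarrow> complex"
  assumes anti: "\<And>t \<alpha> \<beta>. H t \<beta> \<alpha> = - H t \<alpha> \<beta>" and F: "\<And>t a b c d. three_term (H t) a b c d = 0"
  shows "partition_function_invariant H" and "kernel_invariant H"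
proof -
  show "partition_function_invariant H"
    unfolding partition_function_invariant_def Let_def
  proof (intro allI impI; elim conjE)
    fix G t \<alpha> \<beta> e11 e12 e13 e21 e23 e24 M\<^sub>1 M\<^sub>1'
    let ?G' = "spider_move G e11 e12 e13 e21 e23 e24"
    let ?K = "kasteleyn H t G \<alpha> \<beta>" and ?K' = "spider_kasteleyn H t G \<alpha> \<beta> e11 e12 e13 e21 e23 e24"
    assume G: "planar_bipartite G" "track_parameters G \<alpha> \<beta>" and site: "spider_site G e11 e12 e13 e21 e23 e24"
      and t: "t (white_of G e11) = t (white_of G e21)"
      and nz: "\<forall>e\<in>edges G. ?K e \<noteq> 0" and nz': "\<forall>e\<in>edges ?G'. ?K' e \<noteq> 0"
      and corr: "corresponding_dimers G ?G' {e11, e12, e13, e21, e23, e24} M\<^sub>1 M\<^sub>1'"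
    interpret spider_move_region G e11 e12 e13 e21 e23 e24
      by (rule planar_spider_move_region[OF G(1) site])
    note coeff = spider_coefficients_antisymmetric[where H = H, OF anti G(1) site G(2) t]
    have "face_partition_function G ?K M\<^sub>1 - face_partition_function ?G' ?K' M\<^sub>1' = 0"
      using partition_function_defect[OF coeff(1-12) coeff(13) bspec[OF nz] bspec[OF nz'] corr]
        F[of "t (white_of G e11)" "\<alpha> e13" "\<alpha> e12" "\<alpha> e23" "\<alpha> e11"]
      by (simp add: three_term_def)
    then show "face_partition_function G ?K M\<^sub>1 = face_partition_function ?G' ?K' M\<^sub>1'"
      by simp
  qed
  show "kernel_invariant H"
    unfolding kernel_invariant_def Let_def
  proof (intro allI impI; elim conjE)
    fix G t \<alpha> \<beta> e11 e12 e13 e21 e23 e24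
    let ?G' = "spider_move G e11 e12 e13 e21 e23 e24"
    let ?K = "kasteleyn H t G \<alpha> \<beta>" and ?K' = "spider_kasteleyn H t G \<alpha> \<beta> e11 e12 e13 e21 e23 e24"
    assume G: "planar_bipartite G" "track_parameters G \<alpha> \<beta>" and site: "spider_site G e11 e12 e13 e21 e23 e24"
      and t: "t (white_of G e11) = t (white_of G e21)"
      and nz: "?K e12 \<noteq> 0" "?K' e11 \<noteq> 0"
    interpret spider_move_region G e11 e12 e13 e21 e23 e24
      by (rule planar_spider_move_region[OF G(1) site])
    note coeff = spider_coefficients_antisymmetric[where H = H, OF anti G(1) site G(2) t]
    show "kasteleyn_kernel G ?K = kasteleyn_kernel ?G' ?K'"
      by (rule kernel_move[OF coeff(1-12) coeff(13) F[unfolded three_term_def] nz[unfolded coeff(2,7)]])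
  qed
qed

text \<open>
  The four train-tracks of the cube cross three edges each on their \<open>\<alpha>\<close> side, and any two of them cross
  twice. So the edge weights are, up to sign, the six values of \<open>H\<close> at pairs of parameters.
\<close>

definition cube_alpha :: "complex \<Rightarrow> complex \<Rightarrow> complex \<Rightarrow> complex \<Rightarrow> nat \<Rightarrow> complex" where
  "cube_alpha a b c d e = [d, b, a, b, c, a, c, d, a, b, d, c] ! e"

lemma cube_alpha_values:
  "cube_alpha a b c d 0 = d" "cube_alpha a b c d 1 = b" "cube_alpha a b c d 2 = a" "cube_alpha a b c d 3 = b"
  "cube_alpha a b c d 4 = c" "cube_alpha a b c d 5 = a" "cube_alpha a b c d 6 = c" "cube_alpha a b c d 7 = d"
  "cube_alpha a b c d 8 = a" "cube_alpha a b c d 9 = b" "cube_alpha a b c d 10 = d" "cube_alpha a b c d 11 = c"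
  by (simp_all add: cube_alpha_def One_nat_def)

text \<open>
  With \<open>p = H(a,b)H(c,d)\<close>, \<open>q = H(a,c)H(d,b)\<close>, \<open>r = H(a,d)H(b,c)\<close>, the configurations using \<open>w\<^sub>1b\<^sub>1, w\<^sub>2b\<^sub>3\<close>
  weigh \<open>- q (q + r)\<close> together and the one using \<open>w\<^sub>1b\<^sub>2, w\<^sub>2b\<^sub>4\<close> weighs \<open>- p p\<close>, up to the common
  denominator \<open>D\<close> given by the reference. Divided by \<open>q\<close> and \<open>p\<close> as in the defect formula they add up to
  \<open>- (p + q + r) / D\<close>, so the defect is minus the square of the three-term sum, over \<open>D\<close>.
\<close>

lemma invariant_imp_three_term_generic:
  fixes H :: "complex \<Rightarrow> complex \<Rightarrow> complex \<Rightarrow> complex"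
  assumes anti: "\<And>t \<alpha> \<beta>. H t \<beta> \<alpha> = - H t \<alpha> \<beta>" and inv: "partition_function_invariant H"
    and nz: "H t a b \<noteq> 0" "H t a c \<noteq> 0" "H t a d \<noteq> 0" "H t b c \<noteq> 0" "H t b d \<noteq> 0" "H t c d \<noteq> 0"
  shows "three_term (H t) a b c d = 0"
proof -
  define \<alpha> \<beta> where "\<alpha> = cube_alpha a b c d" and "\<beta> e = \<alpha> (cube_rotW e)" for e
  let ?t = "\<lambda>_. t"
  let ?K = "kasteleyn H ?t cube \<alpha> \<beta>" and ?K' = "spider_kasteleyn H ?t cube \<alpha> \<beta> 0 1 2 3 4 5"
  have track: "track_parameters cube \<alpha> \<beta>"
    unfolding track_parameters_def cube_simps by (simp add: \<alpha>_def \<beta>_def cube_values cube_alpha_values)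
  have K: "?K 0 = H t b d" "?K 1 = H t a b" "?K 2 = H t d a" "?K 3 = H t c b" "?K 4 = H t a c" "?K 5 = H t b a"
    "?K 6 = H t d c" "?K 7 = H t a d" "?K 8 = H t c a" "?K 9 = H t d b" "?K 10 = H t c d" "?K 11 = H t b c"
    by (simp_all add: kasteleyn_def \<alpha>_def \<beta>_def cube_values cube_alpha_values)
  have nz_op: "H t b a \<noteq> 0" "H t c a \<noteq> 0" "H t d a \<noteq> 0" "H t c b \<noteq> 0" "H t d b \<noteq> 0" "H t d c \<noteq> 0"
    using nz anti[of t a b] anti[of t a c] anti[of t a d] anti[of t b c] anti[of t b d] anti[of t c d]
    by (metis neg_equal_0_iff_equal)+
  have Knz: "\<forall>e\<in>edges cube. ?K e \<noteq> 0"
    unfolding cube_simps by (simp add: K nz nz_op)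
  note coeff = spider_coefficients_antisymmetric[where H = H and t = ?t,
      OF anti cube_planar cube_site track refl]
  have params: "\<alpha> 0 = d" "\<alpha> 1 = b" "\<alpha> 2 = a" "\<alpha> 4 = c"
    by (simp_all add: \<alpha>_def cube_alpha_values)
  have K'nz: "\<forall>e\<in>edges (spider_move cube 0 1 2 3 4 5). ?K' e \<noteq> 0"
  proof
    fix e assume "e \<in> edges (spider_move cube 0 1 2 3 4 5)"
    then have e: "e \<in> edges cube"
      by (simp add: cube.move_simps)
    show "?K' e \<noteq> 0"
    proof (cases "e \<in> {0, 1, 2, 3, 4, 5}")
      case True
      then show ?thesis
        by (elim insertE emptyE) (simp_all add: coeff params nz nz_op)
    next
      case False
      then show ?thesis
        using coeff(13)[OF False] Knz e by simp
    qed
  qed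
  have "face_partition_function cube ?K {7, 10, 1, 3} =
      face_partition_function (spider_move cube 0 1 2 3 4 5) ?K' {7, 10, 0, 1}"
    using inv[unfolded partition_function_invariant_def Let_def, rule_format,
        of cube \<alpha> \<beta> 0 1 2 3 4 5 ?t "{7, 10, 1, 3}" "{7, 10, 0, 1}"]
      cube_planar cube_trivalent track cube_site Knz K'nz cube_reference by blast
  then have defect: "three_term (H t) a b c d *
      ((\<Sum>m\<in>cube.dimer_heights_at {7, 10, 1, 3} (0, 4). dimer_weight cube ?K m) / (H t a c * H t d b) +
       (\<Sum>m\<in>cube.dimer_heights_at {7, 10, 1, 3} (1, 5). dimer_weight cube ?K m) / (H t a b * H t c d)) = 0"
    using cube.partition_function_defect[OF coeff(1-12) coeff(13) bspec[OF Knz] bspec[OF K'nz] cube_reference]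
    by (simp add: params three_term_def)
  define D where "D = H t a b * H t c b * H t a d * H t c d"
  have D: "D \<noteq> 0"
    using nz nz_op by (simp add: D_def)
  have sum_13: "(\<Sum>m\<in>cube.dimer_heights_at {7, 10, 1, 3} (0, 4). dimer_weight cube ?K m) =
      - (H t a c * H t d b) * (H t a c * H t d b + H t a d * H t b c) / D"
  proof -
    have eq: "H t b d * H t a c * H t a d * H t b c - H t b d * H t a c * H t c a * H t d b =
        - (H t a c * H t d b) * (H t a c * H t d b + H t a d * H t b c)"
      unfolding anti[of t d b] anti[of t a c] by algebra
    show ?thesis
      unfolding D_def eq[symmetric] unfolding K[symmetric] by (rule cube_weights(1)) (rule bspec[OF Knz])
  qed
  have sum_24: "(\<Sum>m\<in>cube.dimer_heights_at {7, 10, 1, 3} (1, 5). dimer_weight cube ?K m) =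
      - (H t a b * H t c d) * (H t a b * H t c d) / D"
  proof -
    have eq: "- (H t a b * H t b a * H t d c * H t c d) = - (H t a b * H t c d) * (H t a b * H t c d)"
      unfolding anti[of t a b] anti[of t c d] by algebra
    show ?thesis
      unfolding D_def eq[symmetric] unfolding K[symmetric] by (rule cube_weights(2)) (rule bspec[OF Knz])
  qed
  have cancel: "- p * r / D / p + - q * q / D / q = - (q + r) / D" if "p \<noteq> 0" "q \<noteq> 0" for p q r
    using that D by (simp add: field_simps)
  have "H t a c * H t d b \<noteq> 0" "H t a b * H t c d \<noteq> 0"
    using nz nz_op by simp_all
  then have "three_term (H t) a b c d * (- three_term (H t) a b c d / D) = 0"
    using defect[unfolded sum_13 sum_24] by (simp only: cancel three_term_def add.assoc not_False_eq_True)
  then show ?thesis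
    using D by simp
qed

lemma three_term_repeated:
  fixes h :: "complex \<Rightarrow> complex \<Rightarrow> complex"
  assumes anti: "\<And>\<alpha> \<beta>. h \<beta> \<alpha> = - h \<alpha> \<beta>" and "\<not> distinct [a, b, c, d]"
  shows "three_term h a b c d = 0"
proof -
  have diag: "h x x = 0" for x
    using anti[of x x] by (simp add: eq_neg_iff_add_eq_0 flip: mult_2)
  consider "a = b" | "a = c" | "a = d" | "b = c" | "b = d" | "c = d"
    using assms(2) by auto
  then show ?thesis
    unfolding three_term_def
  proof cases
    case 1
    show "h a b * h c d + h a c * h d b + h a d * h b c = 0"
      unfolding 1[symmetric] diag using anti[of d a] by algebra
  next
    case 2
    show "h a b * h c d + h a c * h d b + h a d * h b c = 0"
      unfolding 2[symmetric] diag using anti[of b a] by algebra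
  next
    case 3
    show "h a b * h c d + h a c * h d b + h a d * h b c = 0"
      unfolding 3[symmetric] diag using anti[of c a] by algebra
  next
    case 4
    show "h a b * h c d + h a c * h d b + h a d * h b c = 0"
      unfolding 4[symmetric] diag using anti[of d b] by algebra
  next
    case 5
    show "h a b * h c d + h a c * h d b + h a d * h b c = 0"
      unfolding 5[symmetric] diag using anti[of c b] by algebra
  next
    case 6
    show "h a b * h c d + h a c * h d b + h a d * h b c = 0"
      unfolding 6[symmetric] diag using anti[of c b] by algebra
  qed
qed

text \<open>
  In terms of the six values \<open>H(a,b), \<dots>, H(c,d)\<close> the relation is the Pluecker relation, a polynomial equation.
\<close>

lemma closed_plucker_relation:
  "closed {(ab, ac, ad, bc, bd, cd). ab * cd - ac * bd + ad * bc = (0 :: complex)}"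
  unfolding case_prod_beta by (intro closed_Collect_eq continuous_intros)

lemma invariant_imp_three_term:
  fixes H :: "complex \<Rightarrow> complex \<Rightarrow> complex \<Rightarrow> complex"
  assumes anti: "\<And>t \<alpha> \<beta>. H t \<beta> \<alpha> = - H t \<alpha> \<beta>" and generic: "generically_nonzero H"
    and inv: "partition_function_invariant H"
  shows "three_term (H t) a b c d = 0"
proof (cases "distinct [a, b, c, d]")
  case False
  then show ?thesis
    by (intro three_term_repeated anti)
next
  case True
  let ?V = "{pair_values H t' a' b' c' d' | t' a' b' c' d'.
    H t' a' b' \<noteq> 0 \<and> H t' a' c' \<noteq> 0 \<and> H t' a' d' \<noteq> 0 \<and> H t' b' c' \<noteq> 0 \<and> H t' b' d' \<noteq> 0 \<and> H t' c' d' \<noteq> 0}"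
  let ?P = "{(ab, ac, ad, bc, bd, cd). ab * cd - ac * bd + ad * bc = (0 :: complex)}"
  have plucker: "pair_values H t' a' b' c' d' \<in> ?P \<longleftrightarrow> three_term (H t') a' b' c' d' = 0" for t' a' b' c' d'
    by (simp add: pair_values_def three_term_def anti[of t' d' b'])
  have "?V \<subseteq> ?P"
  proof
    fix v assume "v \<in> ?V"
    then obtain t' a' b' c' d' where v: "v = pair_values H t' a' b' c' d'"
      and nz: "H t' a' b' \<noteq> 0" "H t' a' c' \<noteq> 0" "H t' a' d' \<noteq> 0" "H t' b' c' \<noteq> 0" "H t' b' d' \<noteq> 0"
        "H t' c' d' \<noteq> 0"
      by (elim CollectE exE conjE)
    show "v \<in> ?P"
      unfolding v plucker by (rule invariant_imp_three_term_generic[OF anti inv nz])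
  qed
  then have "closure ?V \<subseteq> ?P"
    by (rule closure_minimal[OF _ closed_plucker_relation])
  moreover have "pair_values H t a b c d \<in> closure ?V"
    using generic[unfolded generically_nonzero_def] True by (elim allE impE)
  ultimately show ?thesis
    unfolding plucker[symmetric] by (rule subsetD)
qed

theorem theorem54:
  fixes H :: "complex \<Rightarrow> complex \<Rightarrow> complex \<Rightarrow> complex"
  assumes antisymmetric: "\<And>t \<alpha> \<beta>. H t \<beta> \<alpha> = - H t \<alpha> \<beta>"
    and generic: "generically_nonzero H"
  shows "(partition_function_invariant H \<longleftrightarrow>
           (\<forall>t a b c d. H t a b * H t c d + H t a c * H t d b + H t a d * H t b c = 0))
       \<and> ((\<forall>t a b c d. H t a b * H t c d + H t a c * H t d b + H t a d * H t b c = 0) \<longrightarrow>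
           kernel_invariant H)"
  using three_term_imp_invariant[of H, OF antisymmetric]
    invariant_imp_three_term[of H, OF antisymmetric generic]
  unfolding three_term_def by blast

end
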